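(* Let $n\geq 3$ and $k\geq 1$ be integers, and let $P_1,\dots,P_k$ and $P$ be regular $n$-gons in the unit sphere $\mathbb{S}^2$ with areas $a_1,\dots,a_k$ and $a$ respectively, satisfying $\sum_{i=1}^k a_i=a$. Then $$\mathrm{perim}(P)\leq\sum_{i=1}^k\mathrm{perim}(P_i),$$ and equality occurs only in the case $k=1$.
   Context: Spherical polygons are geodesic polygons on the unit sphere $\mathbb{S}^2$ (constant curvature $1$) and are non-degenerate (non-zero area). A regular $n$-gon has all sides equal and all interior angles equal. A regular spherical $n$-gon with interior angle $\theta$ has area $n\theta-(n-2)\pi$, and its interior angle satisfies $\frac{(n-2)\pi}{n}<\theta<\pi$; $\mathrm{perim}$ denotes the perimeter. *)

theory Defs
  imports "HOL-Analysis.Analysis"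
begin

unbundle cross3_syntax

text \<open>
  A simple closed curve on the sphere bounds two regions, so a polygon consists of its cyclic
  list of vertices together with the region it encloses. The vertices are listed
  counterclockwise as seen from outside the sphere, i.e. the region lies to the left of each side.
\<close>

record spherical_polygon =
  vertices :: "(real^3) list"
  region :: "(real^3) set"

definition vertex :: "spherical_polygon \<Rightarrow> nat \<Rightarrow> real^3" where
  "vertex P i = vertices P ! (i mod length (vertices P))"

text \<open>The shorter great-circle arc between consecutive vertices is the radial projection of
  their chord.\<close>

definition side :: "spherical_polygon \<Rightarrow> nat \<Rightarrow> (real^3) set" where
  "side P i = sgn ` closed_segment (vertex P i) (vertex P (Suc i))"

definition boundary :: "spherical_polygon \<Rightarrow> (real^3) set" where
  "boundary P = (\<Union>i<length (vertices P). side P i)"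

text \<open>At a point of the side from \<open>p\<close> to \<open>q\<close>, the tangent vector \<open>p \<times> q\<close> is normal to the side
  and points to its left. The region is open in the sphere; it is a nonempty component, so its
  area is automatically nonzero.\<close>

definition is_spherical_polygon :: "spherical_polygon \<Rightarrow> bool" where
  "is_spherical_polygon P \<longleftrightarrow>
     (let n = length (vertices P) in
       3 \<le> n \<and> distinct (vertices P) \<and> set (vertices P) \<subseteq> sphere 0 1 \<and>
       (\<forall>i<n. vertex P (Suc i) \<noteq> - vertex P i) \<and>
       (\<forall>i<n. \<forall>j<n. i \<noteq> j \<longrightarrow>
          side P i \<inter> side P j =
            {vertex P i, vertex P (Suc i)} \<inter> {vertex P j, vertex P (Suc j)}) \<and>
       region P \<in> components (sphere 0 1 - boundary P) \<and>
       (\<forall>i<n. \<forall>x \<in> side P i - {vertex P i, vertex P (Suc i)}.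
          \<forall>\<^sub>F t in at_right 0.
            sgn (x + t *\<^sub>R (vertex P i \<times> vertex P (Suc i))) \<in> region P))"

definition side_length :: "spherical_polygon \<Rightarrow> nat \<Rightarrow> real" where
  "side_length P i = arccos (vertex P i \<bullet> vertex P (Suc i))"

definition perim :: "spherical_polygon \<Rightarrow> real" where
  "perim P = (\<Sum>i<length (vertices P). side_length P i)"

text \<open>Component of \<open>q\<close> tangent to the sphere at \<open>p\<close>: the initial direction of the arc from
  \<open>p\<close> to \<open>q\<close>.\<close>

definition direction :: "real^3 \<Rightarrow> real^3 \<Rightarrow> real^3" where
  "direction p q = q - (p \<bullet> q) *\<^sub>R p"

text \<open>Since the region is on the left, the interior angle at a vertex is the counterclockwise
  angle, in \<open>[0, 2\<pi>)\<close>, from the outgoing side to the incoming one. For tangent vectors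
  \<open>u, w\<close> at \<open>p\<close>, \<open>u \<bullet> w\<close> and \<open>p \<bullet> (u \<times> w)\<close> are \<open>norm u * norm w\<close> times the cosine and the sine
  of the counterclockwise angle from \<open>u\<close> to \<open>w\<close>.\<close>

definition interior_angle :: "spherical_polygon \<Rightarrow> nat \<Rightarrow> real" where
  "interior_angle P i =
     (let p = vertex P i;
          u = direction p (vertex P (Suc i));
          w = direction p (vertex P (i + length (vertices P) - 1))
      in Arg2pi (Complex (u \<bullet> w) (p \<bullet> (u \<times> w))))"

text \<open>Surface area via the solid cone: a subset of the unit sphere has three times the volume
  of the cone over it with apex the origin (normalised so that the sphere has area \<open>4\<pi>\<close>).\<close>

definition sphere_area :: "(real^3) set \<Rightarrow> real" where
  "sphere_area D = 3 * measure lebesgue {t *\<^sub>R x | t x. 0 \<le> t \<and> t \<le> 1 \<and> x \<in> D}"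

definition area :: "spherical_polygon \<Rightarrow> real" where
  "area P = sphere_area (region P)"

text \<open>The bound \<open>\<theta> < \<pi>\<close> is the usual convention that excludes a hemisphere and the complement
  of a regular polygon, which also have equal sides and equal interior angles.\<close>

definition regular_ngon :: "nat \<Rightarrow> spherical_polygon \<Rightarrow> bool" where
  "regular_ngon n P \<longleftrightarrow>
     is_spherical_polygon P \<and> length (vertices P) = n \<and>
     (\<exists>l. \<forall>i<n. side_length P i = l) \<and>
     (\<exists>\<theta><pi. \<forall>i<n. interior_angle P i = \<theta>)"

end

(*
  Let l be the side length of a regular n-gon of interior angle 2 b. Cutting it into n isosceles
  triangles from its centre gives sin b * cos (l/2) = cos (pi/n), and Girard's formula for these
  triangles gives area 2 n b - (n - 2) pi. Hence the perimeter is a function of the area x on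
  [0, 2 pi) that vanishes at 0 and is continuous with strictly decreasing derivative on (0, 2 pi);
  such a function is strictly subadditive.

  A polygon with equal sides and equal angles below pi turns left at every vertex, so the planes
  through three consecutive vertices all coincide and the vertices lie on a circle, successive ones
  differing by a rotation through a fixed angle p. If p were not 2 pi/n, two sides would cross. The
  region is then the intersection of the hemispheres to the left of the sides.
*)

theory Submission
  imports Defs
begin

section \<open>Volumes of polyhedral cones in the unit ball\<close>

text \<open>Area is defined as a volume, so Girard's formula becomes a statement about the unit ball
  cut by half-spaces through the origin. It rests on wedges between two such half-spaces: their
  volume is nonnegative and additive in the opening angle, hence linear in it. Regularity, in
  contrast, is local: it compares consecutive vertices and says nothing directly about the region.
  The interior angle \<open>\<theta>\<close> enters through the triple product of three consecutive
  vertices, a positive multiple of \<open>sin \<theta>\<close>, whose sign is the left turn. The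
  region has to be recovered from connectedness alone, as a component of the complement of the
  boundary. The relation between base angle and side is Napier's rule for the right triangle formed
  by the centre, a vertex and the midpoint of a side. Since arccos has a vertical tangent at 1, the
  value reached at area 0, the perimeter is differentiated at positive areas only and 0 is covered
  by continuity.\<close>

lemma additive_nonneg_imp_linear:
  fixes g :: "real \<Rightarrow> real"
  assumes add: "\<And>x y. 0 \<le> x \<Longrightarrow> 0 \<le> y \<Longrightarrow> x + y \<le> L \<Longrightarrow> g (x + y) = g x + g y"
    and nonneg: "\<And>x. 0 \<le> x \<Longrightarrow> x \<le> L \<Longrightarrow> 0 \<le> g x"
    and x: "0 \<le> x" "x \<le> L"
  shows "L * g x = x * g L"
proof (cases "L = 0")
  case True
  then show ?thesis using x by simp
next
  case False
  then have L: "L > 0" using x by simp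
  have mono: "g u \<le> g w" if "0 \<le> u" "u \<le> w" "w \<le> L" for u w
    using add[of u "w - u"] nonneg[of "w - u"] that by simp
  have mult: "g (real k * u) = real k * g u" if "0 \<le> u" "real k * u \<le> L" for k u
    using that(2)
  proof (induction k)
    case 0
    then show ?case using add[of 0 0] L by simp
  next
    case (Suc k)
    have "g (real k * u + u) = g (real k * u) + g u"
      by (rule add) (use Suc.prems that(1) in \<open>auto simp: algebra_simps\<close>)
    then show ?case using Suc that(1) by (simp add: algebra_simps)
  qed
  have gL: "0 \<le> g L" using nonneg L by simp
  \<comment> \<open>Catching \<open>x\<close> between consecutive multiples of
    \<open>u = L / N\<close> bounds the difference of \<open>u * g x\<close> and
    \<open>x * g u\<close> by \<open>u * g u\<close>. Scaling by \<open>N\<close> and letting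
    \<open>N\<close> grow forces equality.\<close>
  have bound: "\<bar>L * g x - x * g L\<bar> * real N \<le> L * g L" if N: "N > 0" for N :: nat
  proof -
    define u where "u = L / real N"
    define k where "k = nat \<lfloor>x / u\<rfloor>"
    have u: "u > 0" "real N * u = L" using L N by (auto simp: u_def)
    have k: "real k * u \<le> x" "x < (real k + 1) * u"
    proof -
      have "real k = of_int \<lfloor>x / u\<rfloor>" unfolding k_def using x u by simp
      then have "real k \<le> x / u" "x / u < real k + 1" by linarith+
      then show "real k * u \<le> x" "x < (real k + 1) * u" using u by (simp_all add: field_simps)
    qed
    have gu: "real N * g u = g L" using mult[of u N] u by simp
    have low: "real k * g u \<le> g x"
      using mult[of u k] mono[of "real k * u" x] k u x by simp
    have up: "g x \<le> (real k + 1) * g u"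
    proof (cases "(real k + 1) * u \<le> L")
      case True
      then show ?thesis using mult[of u "Suc k"] mono[of x "real (Suc k) * u"] k u x
        by (simp add: algebra_simps)
    next
      \<comment> \<open>Only \<open>x = L\<close> leads here. As \<open>(k + 1) * u\<close> lies
        beyond \<open>L\<close>, where nothing is assumed about \<open>g\<close>, the comparison
        goes through \<open>g L = N * g u\<close>.\<close>
      case False
      then have "N < Suc k" using u by (metis mult_le_cancel_right not_less of_nat_Suc of_nat_mono add.commute less_eq_real_def)
      then have "real N \<le> real k + 1" by linarith
      then have "g L \<le> (real k + 1) * g u"
        using gu nonneg[of u] u N L mult_right_mono[of "real N" "real k + 1" "g u"]
        by (simp add: u_def divide_le_eq)
      then show ?thesis using mono[of x L] x by linarith
    qed
    have gu0: "g u \<ge> 0" using gu gL N zero_le_mult_iff[of "real N" "g u"] by auto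
    have a1: "u * g x \<le> u * ((real k + 1) * g u)" "u * (real k * g u) \<le> u * g x"
      using low up u by simp_all
    have a2: "x * g u \<le> (real k + 1) * u * g u" "real k * u * g u \<le> x * g u"
      using k gu0 by (auto intro!: mult_right_mono)
    have "\<bar>u * g x - x * g u\<bar> \<le> u * g u" using a1 a2 by (simp add: algebra_simps abs_le_iff)
    then have "real N * \<bar>u * g x - x * g u\<bar> * real N \<le> real N * (u * g u) * real N"
      by (intro mult_right_mono mult_left_mono) auto
    moreover have "real N * \<bar>u * g x - x * g u\<bar> = \<bar>L * g x - x * g L\<bar>"
    proof -
      have "real N * \<bar>u * g x - x * g u\<bar> = \<bar>real N * (u * g x - x * g u)\<bar>" by (simp add: abs_mult)
      also have "real N * (u * g x - x * g u) = (real N * u) * g x - x * (real N * g u)"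
        by (simp add: algebra_simps)
      finally show ?thesis using u gu by simp
    qed
    moreover have "real N * (u * g u) * real N = (real N * u) * (real N * g u)" by simp
    ultimately show ?thesis using u gu by simp
  qed
  show ?thesis
  proof (rule ccontr)
    assume "L * g x \<noteq> x * g L"
    then have pos: "\<bar>L * g x - x * g L\<bar> > 0" by simp
    obtain N :: nat where N: "L * g L < real N * \<bar>L * g x - x * g L\<bar>"
      using pos reals_Archimedean3 by blast
    have "N > 0" using N L gL by (cases N) (auto simp: mult_less_0_iff not_less)
    from bound[OF this] N show False by (simp add: mult.commute)
  qed
qed

text \<open>Taking closed half-spaces gives compactness and hence measurability. Cutting along the
  plane normal to \<open>p\<close> inserts \<open>p\<close> or \<open>- p\<close> into the set of
  normals, and the two parts overlap only in that plane.\<close>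

definition ball_cone :: "(real^3) set \<Rightarrow> (real^3) set" where
  "ball_cone A = {x \<in> cball 0 1. \<forall>p\<in>A. 0 \<le> p \<bullet> x}"

lemma compact_ball_cone: "compact (ball_cone A)"
proof -
  have "ball_cone A = cball 0 1 \<inter> (\<Inter>p\<in>A. {x. p \<bullet> x \<ge> 0})"
    by (auto simp: ball_cone_def)
  then show ?thesis
    by (simp add: compact_Int_closed closed_INT closed_halfspace_ge)
qed

lemma lmeasurable_ball_cone [simp]: "ball_cone A \<in> lmeasurable"
  by (simp add: compact_ball_cone lmeasurable_compact)

lemma ball_cone_insert_Un: "ball_cone (insert p A) \<union> ball_cone (insert (- p) A) = ball_cone A"
  by (auto simp: ball_cone_def)

lemma negligible_ball_cone_opposite:
  assumes "p \<noteq> 0" "p \<in> A" "- p \<in> B"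
  shows "negligible (ball_cone A \<inter> ball_cone B)"
proof (rule negligible_subset)
  show "negligible {x. p \<bullet> x = 0}" using assms by (simp add: negligible_hyperplane)
qed (use assms in \<open>force simp: ball_cone_def\<close>)

lemma measure_ball_cone_split:
  assumes "p \<noteq> 0"
  shows "measure lebesgue (ball_cone A) =
    measure lebesgue (ball_cone (insert p A)) + measure lebesgue (ball_cone (insert (- p) A))"
proof -
  have "negligible (ball_cone (insert p A) \<inter> ball_cone (insert (- p) A))"
    by (rule negligible_ball_cone_opposite[OF assms]) auto
  then show ?thesis
    using measure_Un3[of "ball_cone (insert p A)" lebesgue "ball_cone (insert (- p) A)"]
    by (simp add: ball_cone_insert_Un negligible_imp_measure0)
qed

lemma measure_ball_cone_orthogonal:
  assumes "orthogonal_transformation T"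
  shows "measure lebesgue (ball_cone (T ` A)) = measure lebesgue (ball_cone A)"
proof -
  have "ball_cone (T ` A) = T ` ball_cone A"
  proof (intro equalityI subsetI)
    fix y assume y: "y \<in> ball_cone (T ` A)"
    obtain x where "y = T x"
      using orthogonal_transformation_surj[OF assms] by (metis surjD)
    then show "y \<in> T ` ball_cone A"
      using y assms by (auto simp: ball_cone_def orthogonal_transformation_def orthogonal_transformation_norm)
  qed (use assms in \<open>auto simp: ball_cone_def orthogonal_transformation_def orthogonal_transformation_norm\<close>)
  then show ?thesis using measure_orthogonal_image[OF assms, of "ball_cone A"] by simp
qed

lemma measure_ball_cone_uminus:
  "measure lebesgue (ball_cone (uminus ` A)) = measure lebesgue (ball_cone A)"
  by (intro measure_ball_cone_orthogonal)
     (simp add: orthogonal_transformation_neg[of "\<lambda>x. x"] orthogonal_transformation_id)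

text \<open>The Householder reflection in the hyperplane orthogonal to \<open>w\<close>; for
  \<open>w = 0\<close> it is the identity.\<close>

lemma orthogonal_transformation_reflection:
  fixes w :: "'a::real_inner"
  shows "orthogonal_transformation (\<lambda>x. x - (2 * (x \<bullet> w) / (w \<bullet> w)) *\<^sub>R w)"
  by (cases "w = 0")
     (auto simp: orthogonal_transformation_def inner_diff inner_commute inner_add field_simps
           scaleR_add_left[symmetric] add_divide_distrib[symmetric] simp del: scaleR_add_left intro!: linearI)

lemma reflection_swaps:
  fixes u v :: "'a::real_inner"
  assumes "norm u = norm v"
  shows "u - (2 * (u \<bullet> (u - v)) / ((u - v) \<bullet> (u - v))) *\<^sub>R (u - v) = v"
proof (cases "u = v")
  case False
  then have "(u - v) \<bullet> (u - v) \<noteq> 0" by simp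
  moreover have "2 * (u \<bullet> (u - v)) = (u - v) \<bullet> (u - v)"
    using assms by (simp add: inner_diff inner_commute norm_eq)
  ultimately show ?thesis by simp
qed simp

text \<open>Two reflections suffice: the first takes \<open>p\<close> to \<open>p'\<close>, the
  second takes the image of \<open>q\<close> to \<open>q'\<close>. The second fixes
  \<open>p'\<close> because equality of the inner products makes its mirror vector orthogonal to
  \<open>p'\<close>.\<close>

lemma orthogonal_transformation_pair_exists:
  fixes p q p' q' :: "'a::real_inner"
  assumes n: "norm p = norm p'" "norm q = norm q'" and i: "p \<bullet> q = p' \<bullet> q'"
  obtains T where "orthogonal_transformation T" "T p = p'" "T q = q'"
proof -
  define S where "S = (\<lambda>x. x - (2 * (x \<bullet> (p - p')) / ((p - p') \<bullet> (p - p'))) *\<^sub>R (p - p'))"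
  have S: "orthogonal_transformation S" "S p = p'"
    unfolding S_def using orthogonal_transformation_reflection reflection_swaps n by blast+
  define w where "w = S q - q'"
  define R where "R = (\<lambda>x. x - (2 * (x \<bullet> w) / (w \<bullet> w)) *\<^sub>R w)"
  have nS: "norm (S q) = norm q'"
    using S n by (simp add: orthogonal_transformation_norm)
  have R: "orthogonal_transformation R" "R (S q) = q'"
    unfolding R_def w_def using orthogonal_transformation_reflection reflection_swaps nS by blast+
  have "p' \<bullet> S q = p \<bullet> q" using S by (metis orthogonal_transformation_def)
  then have "p' \<bullet> w = 0" using i by (simp add: w_def inner_diff)
  then have "R p' = p'" by (simp add: R_def)
  then show ?thesis
    using that[of "R \<circ> S"] S R orthogonal_transformation_compose by auto
qed

lemma measure_ball_cone_pair_cong: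
  assumes "norm p = norm p'" "norm q = norm q'" "p \<bullet> q = p' \<bullet> q'"
  shows "measure lebesgue (ball_cone {p, q}) = measure lebesgue (ball_cone {p', q'})"
  using orthogonal_transformation_pair_exists[OF assms] measure_ball_cone_orthogonal[of _ "{p, q}"]
  by (metis image_empty image_insert)

lemma measure_ball_cone_empty: "measure lebesgue (ball_cone {}) = 4 / 3 * pi"
proof -
  have "ball_cone {} = cball 0 1" by (auto simp: ball_cone_def)
  then show ?thesis by (simp add: content_cball unit_ball_vol_3)
qed

lemma measure_ball_cone_single:
  assumes "p \<noteq> 0"
  shows "measure lebesgue (ball_cone {p}) = 2 / 3 * pi"
  using measure_ball_cone_split[OF assms, of "{}"] measure_ball_cone_uminus[of "{p}"]
  by (simp add: measure_ball_cone_empty)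

text \<open>The volume depends only on the angle between the two half-planes, and is additive in it.\<close>

lemma measure_ball_cone_pair:
  assumes p: "norm p = 1" and q: "norm q = 1"
  shows "measure lebesgue (ball_cone {p, q}) = 2 / 3 * (pi - arccos (p \<bullet> q))"
proof -
  define F :: "real \<Rightarrow> real^3" where "F t = cos t *\<^sub>R axis 1 1 + sin t *\<^sub>R axis 2 1" for t
  have FF: "F s \<bullet> F t = cos (s - t)" for s t
    by (simp add: F_def inner_add inner_axis_axis cos_diff)
  have nF: "norm (F t) = 1" for t
    by (simp add: norm_eq_sqrt_inner FF)
  then have F0: "F t \<noteq> 0" for t by (metis norm_zero zero_neq_one)
  \<comment> \<open>The volume of a wedge of opening \<open>\<alpha>\<close>: the second normal is
    \<open>- F \<alpha>\<close>, so the wedge is null at 0 and a half ball at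
    \<open>pi\<close>.\<close>
  define g where "g \<alpha> = measure lebesgue (ball_cone {F 0, - F \<alpha>})" for \<alpha>
  have shift: "measure lebesgue (ball_cone {F s, - F (s + \<alpha>)}) = g \<alpha>" for s \<alpha>
    unfolding g_def by (rule measure_ball_cone_pair_cong) (simp_all add: nF FF)
  have g0: "g 0 = 0"
    unfolding g_def
    using negligible_ball_cone_opposite[of "F 0" "{F 0, - F 0}" "{F 0, - F 0}"] F0
    by (simp add: negligible_imp_measure0)
  \<comment> \<open>A linear relation between three vectors of the circle. When the plane normal to
    \<open>F \<alpha>\<close> cuts the large wedge, it makes one of the old half-spaces redundant on
    either side, so that both parts are again wedges.\<close>
  have combo: "sin \<beta> * (F 0 \<bullet> x) + sin \<alpha> * (F (\<alpha> + \<beta>) \<bullet> x) = sin (\<alpha> + \<beta>) * (F \<alpha> \<bullet> x)" for \<alpha> \<beta> x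
  proof -
    have "sin \<beta> + sin \<alpha> * cos (\<alpha> + \<beta>) = sin (\<alpha> + \<beta>) * cos \<alpha>"
    proof -
      have "sin (\<alpha> + \<beta>) * cos \<alpha> - cos (\<alpha> + \<beta>) * sin \<alpha> = sin \<beta>"
        using sin_diff[of "\<alpha> + \<beta>" \<alpha>] by simp
      then show ?thesis by (simp add: mult.commute)
    qed
    moreover have "F t \<bullet> x = cos t * (axis 1 1 \<bullet> x) + sin t * (axis 2 1 \<bullet> x)" for t
      by (simp add: F_def inner_add)
    ultimately show ?thesis
      by (simp add: algebra_simps) (simp only: distrib_right[symmetric] mult.assoc[symmetric])
  qed
  have add: "g (\<alpha> + \<beta>) = g \<alpha> + g \<beta>" if ab: "0 \<le> \<alpha>" "0 \<le> \<beta>" "\<alpha> + \<beta> \<le> pi" for \<alpha> \<beta>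
  proof (cases "\<alpha> = 0 \<or> \<beta> = 0")
    case False
    then have pos: "sin \<alpha> > 0" "sin \<beta> > 0" "sin (\<alpha> + \<beta>) \<ge> 0"
      using ab by (auto intro!: sin_gt_zero sin_ge_zero)
    have "0 \<le> F 0 \<bullet> x" if "0 \<le> F \<alpha> \<bullet> x" "0 \<le> - (F (\<alpha> + \<beta>) \<bullet> x)" for x
    proof -
      have "0 \<le> sin \<beta> * (F 0 \<bullet> x)"
        using combo[of \<beta> x \<alpha>] that pos mult_nonneg_nonneg[of "sin (\<alpha> + \<beta>)" "F \<alpha> \<bullet> x"]
          mult_nonneg_nonneg[of "sin \<alpha>" "- (F (\<alpha> + \<beta>) \<bullet> x)"] by linarith
      then show ?thesis using pos by (simp add: zero_le_mult_iff)
    qed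
    then have 1: "ball_cone {F \<alpha>, F 0, - F (\<alpha> + \<beta>)} = ball_cone {F \<alpha>, - F (\<alpha> + \<beta>)}"
      by (auto simp: ball_cone_def)
    have "0 \<le> - (F (\<alpha> + \<beta>) \<bullet> x)" if "0 \<le> - (F \<alpha> \<bullet> x)" "0 \<le> F 0 \<bullet> x" for x
    proof -
      have "0 \<le> sin \<alpha> * - (F (\<alpha> + \<beta>) \<bullet> x)"
        using combo[of \<beta> x \<alpha>] that pos mult_nonneg_nonneg[of "sin (\<alpha> + \<beta>)" "- (F \<alpha> \<bullet> x)"]
          mult_nonneg_nonneg[of "sin \<beta>" "F 0 \<bullet> x"] by linarith
      then show ?thesis using pos by (simp add: zero_le_mult_iff mult_le_0_iff)
    qed
    then have 2: "ball_cone {- F \<alpha>, F 0, - F (\<alpha> + \<beta>)} = ball_cone {F 0, - F \<alpha>}"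
      by (auto simp: ball_cone_def)
    show ?thesis
      using measure_ball_cone_split[OF F0[of \<alpha>], of "{F 0, - F (\<alpha> + \<beta>)}"] shift[of \<alpha> \<beta>]
      unfolding 1 2 by (simp add: g_def)
  qed (use g0 in auto)
  have "- F pi = F 0" by (simp add: F_def)
  then have gpi: "g pi = 2 / 3 * pi"
    unfolding g_def using measure_ball_cone_single[OF F0[of 0]] by simp
  have pq: "\<bar>p \<bullet> q\<bar> \<le> 1" using Cauchy_Schwarz_ineq2[of p q] p q by simp
  \<comment> \<open>The normals of the model wedge have inner product \<open>- cos \<alpha>\<close>,
    which has to match \<open>p \<bullet> q\<close>.\<close>
  define \<alpha> where "\<alpha> = pi - arccos (p \<bullet> q)"
  have \<alpha>: "0 \<le> \<alpha>" "\<alpha> \<le> pi" using pq arccos_bounded[of "p \<bullet> q"] by (auto simp: \<alpha>_def abs_le_iff)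
  have "cos \<alpha> = - (p \<bullet> q)" using pq by (simp add: \<alpha>_def cos_arccos_abs)
  then have "measure lebesgue (ball_cone {p, q}) = g \<alpha>"
    unfolding g_def by (intro measure_ball_cone_pair_cong) (simp_all add: p q nF FF)
  moreover have "pi * g \<alpha> = \<alpha> * g pi"
    by (rule additive_nonneg_imp_linear[OF add _ \<alpha>]) (simp_all add: g_def)
  ultimately show ?thesis using gpi by (simp add: \<alpha>_def)
qed

text \<open>Girard's formula: the hemispheres cut the ball into eight pieces, opposite ones being
  congruent, so three of the wedges and a half ball determine the volume of one piece.\<close>

lemma measure_ball_cone_triple:
  assumes p: "norm p = 1" and q: "norm q = 1" and r: "norm r = 1"
  shows "3 * measure lebesgue (ball_cone {p, q, r}) =
    2 * pi - arccos (p \<bullet> q) - arccos (q \<bullet> r) - arccos (r \<bullet> p)"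
proof -
  let ?V = "\<lambda>A. measure lebesgue (ball_cone A)"
  have nz: "p \<noteq> 0" "q \<noteq> 0" "r \<noteq> 0" using assms by auto
  have "?V {p, q} = ?V {p, q, r} + ?V {p, q, - r}"
    using measure_ball_cone_split[OF nz(3), of "{p, q}"] by (simp add: insert_commute)
  moreover have "?V {q, r} = ?V {p, q, r} + ?V {- p, q, r}"
    using measure_ball_cone_split[OF nz(1), of "{q, r}"] by simp
  moreover have "?V {r, p} = ?V {p, q, r} + ?V {p, - q, r}"
    using measure_ball_cone_split[OF nz(2), of "{p, r}"] by (simp add: insert_commute)
  moreover have "?V {p} = ?V {p, q} + ?V {p, - q}"
    using measure_ball_cone_split[OF nz(2), of "{p}"] by (simp add: insert_commute)
  moreover have "?V {p, - q} = ?V {p, - q, r} + ?V {p, - q, - r}"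
    using measure_ball_cone_split[OF nz(3), of "{p, - q}"] by (simp add: insert_commute)
  moreover have "?V {p, - q, - r} = ?V {- p, q, r}"
    using measure_ball_cone_uminus[of "{- p, q, r}"] by simp
  \<comment> \<open>Together the equations express twice the volume as the three wedges minus the
    half ball. Dihedral angles being \<open>pi\<close> minus angles between normals, the result is
    the angle excess.\<close>
  ultimately show ?thesis
    using measure_ball_cone_pair[OF p q] measure_ball_cone_pair[OF q r]
      measure_ball_cone_pair[OF r p] measure_ball_cone_single[OF nz(1)]
    by argo
qed

section \<open>Perimeter as a function of the area\<close>

text \<open>The base angle of the \<open>n\<close> isosceles triangles with apex at the centre that make up a regular
  \<open>n\<close>-gon of area \<open>x\<close>; it is half of the interior angle.\<close>

definition base_angle :: "nat \<Rightarrow> real \<Rightarrow> real" where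
  "base_angle n x = pi / 2 - pi / n + x / (2 * n)"

definition perim_of_area :: "nat \<Rightarrow> real \<Rightarrow> real" where
  "perim_of_area n x = 2 * n * arccos (cos (pi / n) / sin (base_angle n x))"

lemma cos_pi_div_pos:
  assumes "3 \<le> (n::nat)"
  shows "0 < cos (pi / n)"
proof (rule cos_gt_zero)
  have "pi * 2 < pi * real n" using assms by (intro mult_strict_left_mono) auto
  then show "pi / n < pi / 2" using assms by (simp add: field_simps)
qed (use assms in auto)

text \<open>The base angle reaches \<open>pi / 2\<close> at area \<open>2 * pi\<close>, that of a
  hemisphere; below this its sine increases and its cosine stays positive.\<close>

lemma base_angle_bounds:
  assumes n: "3 \<le> n" and x: "0 \<le> x" "x < 2 * pi"
  shows "0 < base_angle n x" "base_angle n x < pi / 2" "base_angle n 0 \<le> base_angle n x"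
proof -
  have "pi * 2 < pi * real n" using n by (intro mult_strict_left_mono) auto
  then have "pi / n < pi / 2" using n by (simp add: field_simps)
  moreover have "0 \<le> x / (2 * n)" "x / (2 * n) < pi / n"
    using x n by (simp_all add: field_simps)
  ultimately show "0 < base_angle n x" "base_angle n x < pi / 2" "base_angle n 0 \<le> base_angle n x"
    unfolding base_angle_def by (linarith, linarith, simp)
qed

lemma sin_base_angle_0: "sin (base_angle n 0) = cos (pi / n)"
  by (simp add: base_angle_def cos_sin_eq)

lemma base_angle_mono:
  assumes "3 \<le> n" "x < y" shows "base_angle n x < base_angle n y"
  using assms by (simp add: base_angle_def divide_strict_right_mono)

lemma sin_base_angle_mono:
  assumes n: "3 \<le> n" and x: "0 \<le> x" "x < y" "y < 2 * pi"
  shows "sin (base_angle n x) < sin (base_angle n y)"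
  using base_angle_bounds[OF n x(1)] base_angle_bounds[OF n, of y] base_angle_mono[OF n x(2)] x
  by (intro sin_monotone_2pi) auto

lemma sin_base_angle_ge:
  assumes n: "3 \<le> n" and x: "0 \<le> x" "x < 2 * pi"
  shows "cos (pi / n) \<le> sin (base_angle n x)"
  using sin_base_angle_mono[OF n, of 0 x] x by (cases "x = 0") (auto simp: sin_base_angle_0)

lemma cos_base_angle_mono:
  assumes n: "3 \<le> n" and x: "0 \<le> x" "x < y" "y < 2 * pi"
  shows "cos (base_angle n y) < cos (base_angle n x)" "0 < cos (base_angle n y)"
  using base_angle_bounds[OF n x(1)] base_angle_bounds[OF n, of y] base_angle_mono[OF n x(2)] x
  by (auto intro!: cos_monotone_0_pi cos_gt_zero)

text \<open>The derivative of \<open>perim_of_area n\<close>, where the inner factor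
  \<open>1 / (2 * n)\<close> has cancelled the leading \<open>2 * n\<close>. It is grouped into two
  positive factors, each of them strictly decreasing in the area.\<close>

definition perim_rate :: "nat \<Rightarrow> real \<Rightarrow> real" where
  "perim_rate n x = cos (pi / n) * cos (base_angle n x) / (sin (base_angle n x))\<^sup>2 *
     inverse (sqrt (1 - (cos (pi / n) / sin (base_angle n x))\<^sup>2))"

lemma perim_of_area_has_derivative:
  assumes n: "3 \<le> n" and x: "0 < x" "x < 2 * pi"
  shows "(perim_of_area n has_real_derivative perim_rate n x) (at x)"
proof -
  let ?C = "cos (pi / n)" and ?\<beta> = "base_angle n x"
  have C: "0 < ?C" by (rule cos_pi_div_pos[OF n])
  have s: "?C < sin ?\<beta>" using sin_base_angle_mono[OF n, of 0 x] x by (simp add: sin_base_angle_0)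
  have q: "0 < ?C / sin ?\<beta>" "?C / sin ?\<beta> < 1" using C s by simp_all
  have d\<beta>: "(base_angle n has_real_derivative 1 / (2 * n)) (at x)"
    unfolding base_angle_def using n by (auto intro!: derivative_eq_intros)
  have dq: "((\<lambda>x. ?C / sin (base_angle n x)) has_real_derivative
      - (?C * (cos ?\<beta> * (1 / (2 * n)))) / (sin ?\<beta>)\<^sup>2) (at x)"
    using C s by (auto intro!: derivative_eq_intros d\<beta> simp: power2_eq_square)
  have "((\<lambda>x. arccos (?C / sin (base_angle n x))) has_real_derivative
      inverse (- sqrt (1 - (?C / sin ?\<beta>)\<^sup>2)) * (- (?C * (cos ?\<beta> * (1 / (2 * n)))) / (sin ?\<beta>)\<^sup>2)) (at x)"
    by (rule DERIV_chain2[OF DERIV_arccos dq]) (use q in auto)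
  from DERIV_cmult[OF this, of "2 * real n"] show ?thesis
    unfolding perim_of_area_def perim_rate_def by (rule DERIV_cong) (use n in \<open>simp add: field_simps\<close>)
qed

lemma perim_rate_strict_antimono:
  assumes n: "3 \<le> n" and x: "0 < x" "x < y" "y < 2 * pi"
  shows "perim_rate n y < perim_rate n x"
proof -
  let ?C = "cos (pi / n)"
  have C: "0 < ?C" by (rule cos_pi_div_pos[OF n])
  have s: "?C < sin (base_angle n x)" "sin (base_angle n x) < sin (base_angle n y)"
    using sin_base_angle_mono[OF n, of 0 x] sin_base_angle_mono[OF n, of x y] x
    by (simp_all add: sin_base_angle_0)
  have c: "cos (base_angle n y) < cos (base_angle n x)" "0 < cos (base_angle n y)"
    using cos_base_angle_mono[OF n, of x y] x by auto
  have "?C / sin (base_angle n y) < ?C / sin (base_angle n x)"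
    using C s by (intro divide_strict_left_mono) auto
  then have "(?C / sin (base_angle n y))\<^sup>2 < (?C / sin (base_angle n x))\<^sup>2"
    using C s by (intro power_strict_mono) auto
  moreover have "(?C / sin (base_angle n x))\<^sup>2 < 1" using C s by (simp add: power_less_one_iff)
  ultimately have "inverse (sqrt (1 - (?C / sin (base_angle n y))\<^sup>2))
      < inverse (sqrt (1 - (?C / sin (base_angle n x))\<^sup>2))"
    and "0 < inverse (sqrt (1 - (?C / sin (base_angle n y))\<^sup>2))"
    by (auto intro!: less_imp_inverse_less)
  moreover have "?C * cos (base_angle n y) / (sin (base_angle n y))\<^sup>2
      < ?C * cos (base_angle n x) / (sin (base_angle n x))\<^sup>2"
    using C s c by (intro frac_less mult_strict_left_mono power_mono mult_pos_pos) auto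
  ultimately show ?thesis
    unfolding perim_rate_def using C s c by (intro mult_strict_mono) auto
qed

lemma perim_of_area_0: "3 \<le> n \<Longrightarrow> perim_of_area n 0 = 0"
  using cos_pi_div_pos[of n] by (simp add: perim_of_area_def sin_base_angle_0)

lemma continuous_on_perim_of_area:
  assumes n: "3 \<le> n"
  shows "continuous_on {0..<2 * pi} (perim_of_area n)"
proof -
  have "sin (base_angle n x) > 0 \<and> 0 \<le> cos (pi / n) / sin (base_angle n x) \<and>
      cos (pi / n) / sin (base_angle n x) \<le> 1" if "x \<in> {0..<2 * pi}" for x
    using sin_base_angle_ge[OF n, of x] cos_pi_div_pos[OF n] that by auto
  moreover have "continuous_on {0..<2 * pi} (base_angle n)"
    unfolding base_angle_def using n by (intro continuous_intros) auto
  ultimately show ?thesis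
    unfolding perim_of_area_def
    by (intro continuous_intros) (force intro: order_trans[of "-1 :: real" 0])+
qed

lemma perim_of_area_strict_subadditive:
  assumes n: "3 \<le> n" and xy: "0 < x" "0 < y" "x + y < 2 * pi"
  shows "perim_of_area n (x + y) < perim_of_area n x + perim_of_area n y"
proof -
  \<comment> \<open>The defect of additivity with \<open>y\<close> fixed. It vanishes at 0, and its
    derivative \<open>perim_rate n t - perim_rate n (t + y)\<close> is positive.\<close>
  define D where "D t = perim_of_area n t + perim_of_area n y - perim_of_area n (t + y)" for t
  have "D 0 < D x"
  proof (rule DERIV_pos_imp_increasing_open[OF xy(1)])
    fix t assume t: "0 < t" "t < x"
    have "(D has_real_derivative perim_rate n t - perim_rate n (t + y)) (at t)"
      unfolding D_def
      using perim_of_area_has_derivative[OF n, of t]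
        DERIV_shift[THEN iffD1, OF perim_of_area_has_derivative[OF n, of "t + y"]] t xy
      by (auto intro!: derivative_eq_intros)
    then show "\<exists>d. (D has_real_derivative d) (at t) \<and> 0 < d"
      using perim_rate_strict_antimono[OF n, of t "t + y"] t xy by fastforce
  next
    have "continuous_on {0..x} (\<lambda>t. perim_of_area n (t + y))"
      by (rule continuous_on_compose2[OF continuous_on_perim_of_area[OF n]])
         (use xy in \<open>auto intro!: continuous_intros\<close>)
    moreover have "continuous_on {0..x} (perim_of_area n)"
      by (rule continuous_on_subset[OF continuous_on_perim_of_area[OF n]]) (use xy in auto)
    ultimately show "continuous_on {0..x} D"
      unfolding D_def by (intro continuous_intros)
  qed
  then show ?thesis by (simp add: D_def perim_of_area_0[OF n])
qed

lemma perim_of_area_sum: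
  assumes n: "3 \<le> n" and pos: "\<And>i. i \<in> I \<Longrightarrow> 0 < f i" and I: "finite I" "I \<noteq> {}"
    and sum: "sum f I < 2 * pi"
  shows "perim_of_area n (sum f I) \<le> (\<Sum>i\<in>I. perim_of_area n (f i)) \<and>
    (perim_of_area n (sum f I) = (\<Sum>i\<in>I. perim_of_area n (f i)) \<longrightarrow> card I = 1)"
  using I pos sum
proof (induction I rule: finite_ne_induct)
  case (insert i I)
  \<comment> \<open>Both parts of the split are positive, so every insertion makes the inequality
    strict and equality survives only for a singleton.\<close>
  have "0 < f i" "0 < sum f I" using insert by (auto intro: sum_pos)
  then show ?case
    using perim_of_area_strict_subadditive[OF n, of "f i" "sum f I"] insert by force
qed auto

section \<open>Equilateral and equiangular chains on the sphere\<close>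

lemma triple_product_rotate: "x \<bullet> (y \<times> z) = y \<bullet> (z \<times> x)" for x y z :: "real^3"
  by (metis cross_triple inner_commute)

text \<open>Cramer's rule cleared of its denominator. It later yields coordinates with respect to
  the corners of a triangle or the ends of a side.\<close>

lemma triple_product_decomposition:
  fixes p q r y :: "real^3"
  shows "(p \<bullet> (q \<times> r)) *\<^sub>R y =
    (y \<bullet> (q \<times> r)) *\<^sub>R p + (y \<bullet> (r \<times> p)) *\<^sub>R q + (y \<bullet> (p \<times> q)) *\<^sub>R r"
  by (simp add: vec_eq_iff forall_3 cross3_def inner_vec_def sum_3) algebra

lemma eq_if_inner_eq_cross_basis:
  fixes p q x y :: "real^3"
  assumes "p \<times> q \<noteq> 0" "x \<bullet> p = y \<bullet> p" "x \<bullet> q = y \<bullet> q" "x \<bullet> (p \<times> q) = y \<bullet> (p \<times> q)"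
  shows "x = y"
proof -
  define z where "z = x - y"
  have z: "z \<bullet> p = 0" "z \<bullet> q = 0" "z \<bullet> (p \<times> q) = 0"
    using assms by (simp_all add: z_def inner_diff)
  have "((p \<times> q) \<bullet> (p \<times> q)) *\<^sub>R z = (p \<bullet> (q \<times> (p \<times> q))) *\<^sub>R z"
    by (metis triple_product_rotate)
  also have "\<dots> = 0"
    unfolding triple_product_decomposition[of p q "p \<times> q" z]
    using z by (simp add: cross_skew[of "p \<times> q" p] Lagrange inner_diff)
  finally have "z = 0" using assms(1) by simp
  then show ?thesis by (simp add: z_def)
qed

lemma unit_inner_less_1:
  fixes p q :: "'a::real_inner"
  assumes "norm p = 1" "norm q = 1" "p \<noteq> q"
  shows "p \<bullet> q < 1"
proof -
  have "0 < (p - q) \<bullet> (p - q)" using assms(3) by simp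
  also have "\<dots> = 2 - 2 * (p \<bullet> q)"
    using assms(1,2) by (simp add: inner_diff inner_commute norm_eq_1)
  finally show ?thesis by simp
qed

locale oriented_frame =
  fixes e1 e2 c :: "real^3"
  assumes norm_e1: "norm e1 = 1" and norm_e2: "norm e2 = 1" and e1_e2: "e1 \<bullet> e2 = 0"
    and c_eq: "c = e1 \<times> e2"
begin

lemma frame_inner:
  "e1 \<bullet> e1 = 1" "e2 \<bullet> e2 = 1" "c \<bullet> c = 1" "e1 \<bullet> e2 = 0" "e2 \<bullet> e1 = 0"
  "c \<bullet> e1 = 0" "e1 \<bullet> c = 0" "c \<bullet> e2 = 0" "e2 \<bullet> c = 0"
  using norm_e1 norm_e2 e1_e2
  by (simp_all add: c_eq dot_cross dot_cross_self norm_eq_1 inner_commute)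

lemma frame_cross: "e1 \<times> e2 = c" "e2 \<times> c = e1" "c \<times> e1 = e2"
  "e2 \<times> e1 = - c" "c \<times> e2 = - e1" "e1 \<times> c = - e2"
proof -
  show 1: "e1 \<times> e2 = c" "e2 \<times> c = e1" by (simp_all add: c_eq Lagrange frame_inner)
  have "e1 \<times> c = - e2" by (simp add: c_eq Lagrange frame_inner)
  then show "c \<times> e1 = e2" "e1 \<times> c = - e2" by (metis cross_skew minus_minus)+
  show "e2 \<times> e1 = - c" "c \<times> e2 = - e1" using 1 by (metis cross_skew)+
qed

definition E :: "real \<Rightarrow> real^3" where
  "E t = cos t *\<^sub>R e1 + sin t *\<^sub>R e2"

lemma E_inner_E: "E s \<bullet> E t = cos (s - t)"
  by (simp add: E_def inner_add frame_inner cos_diff)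

lemma E_inner_frame: "E t \<bullet> e1 = cos t" "E t \<bullet> e2 = sin t"
  by (simp_all add: E_def inner_add frame_inner)

lemma c_inner_E [simp]: "c \<bullet> E t = 0" "E t \<bullet> c = 0"
  by (simp_all add: E_def inner_add frame_inner)

lemma E_cross_E: "E s \<times> E t = sin (t - s) *\<^sub>R c"
  by (simp add: E_def cross_add_left cross_add_right cross_mult_left cross_mult_right frame_cross
      sin_diff algebra_simps)

lemma E_inner_c_cross_E: "E s \<bullet> (c \<times> E t) = sin (s - t)"
proof -
  have "E s \<bullet> (c \<times> E t) = c \<bullet> (E t \<times> E s)" by (metis triple_product_rotate)
  then show ?thesis by (simp add: E_cross_E frame_inner)
qed

lemma cylindrical:
  obtains r \<psi> z where "0 \<le> r" "0 \<le> \<psi>" "\<psi> < 2 * pi" "y = z *\<^sub>R c + r *\<^sub>R E \<psi>"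
proof -
  have y: "y = (y \<bullet> e1) *\<^sub>R e1 + (y \<bullet> e2) *\<^sub>R e2 + (y \<bullet> c) *\<^sub>R c"
    using triple_product_decomposition[of e1 e2 c y] by (simp add: frame_cross frame_inner)
  define r where "r = sqrt ((y \<bullet> e1)\<^sup>2 + (y \<bullet> e2)\<^sup>2)"
  have r2: "r\<^sup>2 = (y \<bullet> e1)\<^sup>2 + (y \<bullet> e2)\<^sup>2" by (simp add: r_def)
  show ?thesis
  proof (cases "r = 0")
    case True
    then have "y \<bullet> e1 = 0" "y \<bullet> e2 = 0" using r2 by (simp_all add: sum_power2_eq_zero_iff)
    then show ?thesis using that[of 0 0 "y \<bullet> c"] y by simp
  next
    case False
    then have "((y \<bullet> e1) / r)\<^sup>2 + ((y \<bullet> e2) / r)\<^sup>2 = 1"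
      by (simp add: power_divide add_divide_distrib[symmetric] r2[symmetric])
    then obtain \<psi> where \<psi>: "0 \<le> \<psi>" "\<psi> < 2 * pi" "(y \<bullet> e1) / r = cos \<psi>" "(y \<bullet> e2) / r = sin \<psi>"
      by (rule sincos_total_2pi)
    then have "y \<bullet> e1 = r * cos \<psi>" "y \<bullet> e2 = r * sin \<psi>" using False by (simp_all add: field_simps)
    then have "y = (y \<bullet> c) *\<^sub>R c + r *\<^sub>R E \<psi>"
      using y by (simp add: E_def scaleR_add_right ac_simps)
    then show ?thesis using that[of r \<psi> "y \<bullet> c"] \<psi> by (simp add: r_def)
  qed
qed

end

text \<open>The local data of a polygon with equal sides and equal angles, with \<open>d_pos\<close>
  expressing the left turn. Indices run through all naturals because the vertices are repeated
  cyclically.\<close>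

locale left_turning_chain =
  fixes v :: "nat \<Rightarrow> real^3" and a b d :: real
  assumes unit: "norm (v i) = 1"
    and inner_step: "v i \<bullet> v (Suc i) = a"
    and inner_two_steps: "v i \<bullet> v (Suc (Suc i)) = b"
    and triple: "v i \<bullet> (v (Suc i) \<times> v (Suc (Suc i))) = d"
    and d_pos: "0 < d"
begin

lemma inners: "v i \<bullet> v i = 1" "v i \<bullet> v (Suc i) = a" "v (Suc i) \<bullet> v i = a"
    "v i \<bullet> v (Suc (Suc i)) = b" "v (Suc (Suc i)) \<bullet> v i = b"
  using unit[of i] inner_step[of i] inner_two_steps[of i] by (simp_all add: norm_eq_1 inner_commute)

lemma steps_neq: "v i \<noteq> v (Suc i)" "v i \<noteq> v (Suc (Suc i))"
  using triple[of i] d_pos by (auto simp: dot_cross_self)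

lemma a_less_1: "a < 1" and b_less_1: "b < 1"
  using unit_inner_less_1[OF unit unit steps_neq(1), of 0]
    unit_inner_less_1[OF unit unit steps_neq(2), of 0] by (simp_all add: inners)

lemma step_cross_nonzero: "v i \<times> v (Suc i) \<noteq> 0"
  using triple[of i] d_pos
  by (metis cross_triple inner_commute inner_zero_left less_irrefl)

text \<open>Twice the area vector of the triangle formed by three consecutive vertices; it is normal to
  the plane through them.\<close>

definition N :: "nat \<Rightarrow> real^3" where
  "N i = v i \<times> v (Suc i) + v (Suc i) \<times> v (Suc (Suc i)) + v (Suc (Suc i)) \<times> v i"

lemma triples:
  "v i \<bullet> (v (Suc i) \<times> v (Suc (Suc i))) = d"
  "v (Suc i) \<bullet> (v (Suc (Suc i)) \<times> v i) = d"
  "v (Suc (Suc i)) \<bullet> (v i \<times> v (Suc i)) = d"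
  using triple[of i] by (metis triple_product_rotate)+

lemma N_inner:
  "N i \<bullet> v i = d" "N i \<bullet> v (Suc i) = d" "N i \<bullet> v (Suc (Suc i)) = d"
  by (simp_all add: N_def inner_add dot_cross_self inner_commute[of _ "v _"] triples)

lemma N_inner_cross:
  "N i \<bullet> (v i \<times> v (Suc i)) = (1 - a) * (1 - b)"
  "N i \<bullet> (v (Suc i) \<times> v (Suc (Suc i))) = (1 - a) * (1 - b)"
  by (simp_all add: N_def inner_add dot_cross inners algebra_simps)

text \<open>Consecutive triples share two vertices. Both normals have the same inner products with
  these two and with their cross product, and the three vectors form a basis.\<close>

lemma N_Suc: "N (Suc i) = N i"
  by (rule eq_if_inner_eq_cross_basis[OF step_cross_nonzero[of "Suc i"]])
     (simp_all add: N_inner N_inner_cross)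

lemma N_eq: "N i = N 0"
  by (induction i) (simp_all add: N_Suc)

lemma cylindrical_form:
  obtains e1 e2 c h s \<phi> where "oriented_frame e1 e2 c" "0 < h" "0 < s" "h\<^sup>2 + s\<^sup>2 = 1"
    "0 < \<phi>" "\<phi> < pi" "\<And>i. v i = h *\<^sub>R c + s *\<^sub>R oriented_frame.E e1 e2 (i * \<phi>)"
proof -
  have N0: "N 0 \<noteq> 0" using N_inner(1)[of 0] d_pos by auto
  define c where "c = N 0 /\<^sub>R norm (N 0)"
  define h where "h = d / norm (N 0)"
  \<comment> \<open>The component of \<open>v i \<times> v (Suc i)\<close> along the axis. Its
    positivity makes \<open>sin \<phi>\<close> positive and so puts \<open>\<phi>\<close> strictly
    between 0 and \<open>pi\<close>.\<close>
  define \<kappa> where "\<kappa> = (1 - a) * (1 - b) / norm (N 0)"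
  have c: "c \<bullet> c = 1" using N0 by (simp add: c_def power2_norm_eq_inner[symmetric] power2_eq_square flip: norm_eq_1)
  have h: "h > 0" using d_pos N0 by (simp add: h_def)
  have \<kappa>: "\<kappa> > 0" using a_less_1 b_less_1 N0 by (simp add: \<kappa>_def)
  have cv: "c \<bullet> v i = h" "v i \<bullet> c = h" for i
    using N_inner(1)[of i] by (simp_all add: c_def h_def N_eq[of i] inner_commute divide_inverse_commute)
  have cvv: "c \<bullet> (v i \<times> v (Suc i)) = \<kappa>" for i
    using N_inner_cross(1)[of i] by (simp add: c_def \<kappa>_def N_eq[of i] divide_inverse_commute)
  define w where "w i = v i - h *\<^sub>R c" for i
  have cw: "c \<bullet> w i = 0" "w i \<bullet> c = 0" for i
    by (simp_all add: w_def inner_diff cv c)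
  have ww: "w i \<bullet> w i = 1 - h\<^sup>2" "w i \<bullet> w (Suc i) = a - h\<^sup>2" for i
    by (simp_all add: w_def inner_diff cv c inners power2_eq_square)
  have w_neq: "w 0 \<noteq> w 1" using steps_neq(1)[of 0] by (simp add: w_def)
  have "1 - h\<^sup>2 \<noteq> 0" using ww(1)[of 0] ww(1)[of 1] w_neq by auto
  moreover have "0 \<le> 1 - h\<^sup>2" using ww(1)[of 0] by (metis inner_ge_zero)
  ultimately have h2: "0 < 1 - h\<^sup>2" by simp
  define s where "s = sqrt (1 - h\<^sup>2)"
  have s: "s > 0" "s\<^sup>2 = 1 - h\<^sup>2" using h2 by (simp_all add: s_def)
  have cww: "c \<bullet> (w i \<times> w (Suc i)) = \<kappa>" for i
    by (simp add: w_def Cross3.left_diff_distrib Cross3.right_diff_distrib cross_mult_left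
        cross_mult_right inner_diff dot_cross_self cvv)
  \<comment> \<open>The rotation law for the parts orthogonal to the axis:
    \<open>w i \<times> w (Suc i)\<close> equals \<open>\<kappa> *\<^sub>R c\<close>, and its cross
    product with \<open>w i\<close> is evaluated once in this form and once by the double cross
    product rule.\<close>
  have step: "s\<^sup>2 *\<^sub>R w (Suc i) = (a - h\<^sup>2) *\<^sub>R w i + \<kappa> *\<^sub>R (c \<times> w i)" for i
  proof -
    let ?X = "w i \<times> w (Suc i)"
    have "c \<times> ?X = 0" by (simp add: Lagrange cw)
    moreover have "c \<times> (c \<times> ?X) = (c \<bullet> ?X) *\<^sub>R c - ?X"
      using Lagrange[of c c ?X] by (simp add: c)
    ultimately have X: "?X = \<kappa> *\<^sub>R c" by (simp add: cww)
    have "w i \<times> ?X = (a - h\<^sup>2) *\<^sub>R w i - s\<^sup>2 *\<^sub>R w (Suc i)"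
      by (simp add: Lagrange ww s(2))
    moreover have "w i \<times> ?X = - (\<kappa> *\<^sub>R (c \<times> w i))"
      unfolding X using cross_skew[of "w i" c] by (simp add: cross_mult_right)
    ultimately show ?thesis by (simp add: algebra_simps)
  qed
  have "(norm (c \<times> w 0))\<^sup>2 = s\<^sup>2"
    unfolding norm_cross by (simp add: cw power2_norm_eq_inner c ww s)
  then have ccw: "(c \<times> w 0) \<bullet> (c \<times> w 0) = s\<^sup>2" by (simp add: power2_norm_eq_inner)
  \<comment> \<open>Comparing squared norms in \<open>step\<close> shows that its two coefficients,
    divided by \<open>s\<^sup>2\<close>, are the cosine and sine of an angle, the rotation angle
    \<open>\<phi>\<close>.\<close>
  have "s\<^sup>2 * s\<^sup>2 * (w 1 \<bullet> w 1) = (s\<^sup>2 *\<^sub>R w (Suc 0)) \<bullet> (s\<^sup>2 *\<^sub>R w (Suc 0))" by simp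
  also have "\<dots> = (a - h\<^sup>2)\<^sup>2 * (w 0 \<bullet> w 0) + \<kappa>\<^sup>2 * s\<^sup>2"
    unfolding step inner_add
    by (simp add: dot_cross_self inner_commute ccw power2_eq_square)
  finally have "s\<^sup>2 * s\<^sup>2 * s\<^sup>2 = ((a - h\<^sup>2)\<^sup>2 + \<kappa>\<^sup>2) * s\<^sup>2"
    unfolding ww(1) s(2)[symmetric] by (simp only: distrib_right)
  then have "s\<^sup>2 * s\<^sup>2 = (a - h\<^sup>2)\<^sup>2 + \<kappa>\<^sup>2"
    using s(1) by (metis mult_right_cancel zero_less_power less_irrefl)
  moreover have "((a - h\<^sup>2) / s\<^sup>2)\<^sup>2 + (\<kappa> / s\<^sup>2)\<^sup>2 = ((a - h\<^sup>2)\<^sup>2 + \<kappa>\<^sup>2) / (s\<^sup>2 * s\<^sup>2)"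
    by (simp only: power_divide add_divide_distrib power2_eq_square[of "s\<^sup>2"])
  ultimately have "((a - h\<^sup>2) / s\<^sup>2)\<^sup>2 + (\<kappa> / s\<^sup>2)\<^sup>2 = 1"
    using s(1) by (metis divide_self mult_eq_0_iff zero_less_power less_irrefl)
  then obtain \<phi> where \<phi>: "0 \<le> \<phi>" "\<phi> \<le> pi" "(a - h\<^sup>2) / s\<^sup>2 = cos \<phi>" "\<kappa> / s\<^sup>2 = sin \<phi>"
    using sincos_total_pi[of "\<kappa> / s\<^sup>2" "(a - h\<^sup>2) / s\<^sup>2"] \<kappa> by auto
  have "sin \<phi> > 0" using \<phi>(4) \<kappa> s(1) by (metis divide_pos_pos zero_less_power)
  then have \<phi>': "0 < \<phi>" "\<phi> < pi" using \<phi>(1,2) by (force simp: less_le)+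
  define e1 where "e1 = w 0 /\<^sub>R s"
  define e2 where "e2 = c \<times> e1"
  have e1: "e1 \<bullet> e1 = 1" "e1 \<bullet> c = 0" "c \<bullet> e1 = 0"
    using s ww(1)[of 0] by (simp_all add: e1_def cw field_simps power2_eq_square)
  interpret F: oriented_frame e1 e2 c
  proof
    show "norm e1 = 1" using e1 by (simp add: norm_eq_1)
    show "e1 \<bullet> e2 = 0" by (simp add: e2_def dot_cross_self)
    show "norm e2 = 1" using e1 c by (simp add: e2_def norm_eq_1 dot_cross)
    show "c = e1 \<times> e2" using e1 by (simp add: e2_def Lagrange)
  qed
  have "w i = s *\<^sub>R F.E (i * \<phi>)" for i
  proof (induction i)
    case 0
    have "F.E 0 = e1" by (simp add: F.E_def)
    moreover have "w 0 = s *\<^sub>R e1" using s(1) by (simp add: e1_def)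
    ultimately show ?case by simp
  next
    case (Suc i)
    have "w (Suc i) = ((a - h\<^sup>2) / s\<^sup>2) *\<^sub>R w i + (\<kappa> / s\<^sup>2) *\<^sub>R (c \<times> w i)"
    proof -
      have "w (Suc i) = (1 / s\<^sup>2) *\<^sub>R (s\<^sup>2 *\<^sub>R w (Suc i))" using s(1) by simp
      then show ?thesis unfolding step by (simp add: scaleR_add_right)
    qed
    also have "\<dots> = s *\<^sub>R F.E (Suc i * \<phi>)"
      unfolding \<phi> Suc
      by (simp add: F.E_def cross_mult_right cross_add_right F.frame_cross distrib_right
          cos_add sin_add algebra_simps)
    finally show ?case .
  qed
  then have "v i = h *\<^sub>R c + s *\<^sub>R F.E (i * \<phi>)" for i
    by (simp add: w_def algebra_simps)
  then show ?thesis using that F.oriented_frame_axioms h s \<phi>' by simp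
qed

end

section \<open>Polygons in regular position\<close>

locale regular_position = oriented_frame +
  fixes h s \<phi> :: real
  assumes h: "0 < h" and s: "0 < s" and hs: "h\<^sup>2 + s\<^sup>2 = 1" and \<phi>: "0 < \<phi>" "\<phi> < pi"
begin

definition v :: "nat \<Rightarrow> real^3" where
  "v i = h *\<^sub>R c + s *\<^sub>R E (i * \<phi>)"

definition side_normal :: "nat \<Rightarrow> real^3" where
  "side_normal j = v j \<times> v (Suc j)"

lemma sin_\<phi>: "0 < sin \<phi>"
  using \<phi> by (rule sin_gt_zero)

lemma v_inner_v: "v i \<bullet> v j = h\<^sup>2 + s\<^sup>2 * cos ((real i - real j) * \<phi>)"
  by (simp add: v_def inner_add E_inner_E frame_inner algebra_simps power2_eq_square)

lemma norm_v: "norm (v i) = 1"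
  using hs v_inner_v[of i i] by (simp add: norm_eq_1)

lemma v_inner_step: "v i \<bullet> v (Suc i) = h\<^sup>2 + s\<^sup>2 * cos \<phi>"
  using v_inner_v[of i "Suc i"] by (simp add: algebra_simps)

lemma c_inner_v: "c \<bullet> v i = h" "v i \<bullet> c = h"
  by (simp_all add: v_def inner_add frame_inner)

lemma side_normal_eq:
  "side_normal j = (h * s) *\<^sub>R (c \<times> E (Suc j * \<phi>)) - (h * s) *\<^sub>R (c \<times> E (j * \<phi>)) + (s\<^sup>2 * sin \<phi>) *\<^sub>R c"
  by (simp add: side_normal_def v_def cross_add_left cross_add_right cross_mult_left cross_mult_right
      E_cross_E cross_skew[of _ c] algebra_simps power2_eq_square)

lemma c_inner_side_normal: "c \<bullet> side_normal j = s\<^sup>2 * sin \<phi>"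
  by (simp add: side_normal_eq inner_add inner_diff dot_cross_self frame_inner)

lemma c_inner_side_normal_pos: "0 < c \<bullet> side_normal j"
  using s sin_\<phi> by (simp add: c_inner_side_normal)

lemma v_inner_side_normal:
  "v i \<bullet> side_normal j =
    h * s\<^sup>2 * (sin \<phi> - sin ((real i - real j) * \<phi>) + sin ((real i - real j) * \<phi> - \<phi>))"
proof -
  have "v i \<bullet> side_normal j = h * (c \<bullet> side_normal j) + s * (E (i * \<phi>) \<bullet> side_normal j)"
    by (simp add: v_def inner_add)
  also have "E (i * \<phi>) \<bullet> side_normal j =
      h * s * (sin ((real i - real j) * \<phi> - \<phi>) - sin ((real i - real j) * \<phi>))"
    by (simp add: side_normal_eq inner_add inner_diff E_inner_c_cross_E algebra_simps)
  finally show ?thesis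
    by (simp add: c_inner_side_normal algebra_simps power2_eq_square)
qed

text \<open>The angle inside the last cosine leads from the midpoint of side \<open>j\<close> to
  vertex \<open>i\<close>, both seen from the axis. The sign thus records whether that vertex is
  farther from the midpoint than the ends of the side.\<close>

lemma v_inner_side_normal_half:
  "v i \<bullet> side_normal j =
    2 * h * s\<^sup>2 * sin (\<phi> / 2) * (cos (\<phi> / 2) - cos ((real i - real j) * \<phi> - \<phi> / 2))"
proof -
  define x where "x = (real i - real j) * \<phi> - \<phi> / 2"
  have 1: "(real i - real j) * \<phi> = x + \<phi> / 2" "(real i - real j) * \<phi> - \<phi> = x - \<phi> / 2"
    by (simp_all add: x_def)
  have 2: "sin \<phi> = 2 * sin (\<phi> / 2) * cos (\<phi> / 2)" using sin_double[of "\<phi> / 2"] by simp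
  show ?thesis
    unfolding v_inner_side_normal 1 2 x_def[symmetric] by (simp add: sin_add sin_diff algebra_simps)
qed

lemma v_inner_own_side_normal: "v i \<bullet> side_normal i = 0" "v (Suc i) \<bullet> side_normal i = 0"
  by (simp_all add: side_normal_def dot_cross_self)

lemma v_inner_next_side_normal: "0 < v i \<bullet> side_normal (Suc i)" "0 < v (Suc (Suc i)) \<bullet> side_normal i"
proof -
  have "cos \<phi> < 1" using cos_monotone_0_pi[of 0 \<phi>] \<phi> by simp
  then have "0 < h * s\<^sup>2 * (2 * sin \<phi> * (1 - cos \<phi>))" using h s sin_\<phi> by simp
  then have *: "0 < h * s\<^sup>2 * (2 * sin \<phi> - sin (2 * \<phi>))"
    unfolding sin_double by (simp add: algebra_simps)
  have "sin (- \<phi> - \<phi>) = - sin (2 * \<phi>)" by (simp flip: sin_minus)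
  then show "0 < v i \<bullet> side_normal (Suc i)" "0 < v (Suc (Suc i)) \<bullet> side_normal i"
    using * by (simp_all add: v_inner_side_normal)
qed

lemma side_normal_nonzero: "side_normal i \<noteq> 0"
  using c_inner_side_normal_pos[of i] by auto

lemma sgn_combination_not_vertex:
  assumes "\<alpha> \<noteq> 0" "\<beta> \<noteq> 0"
  shows "sgn (\<alpha> *\<^sub>R v i + \<beta> *\<^sub>R v (Suc i)) \<notin> {v i, v (Suc i)}"
proof
  let ?q = "\<alpha> *\<^sub>R v i + \<beta> *\<^sub>R v (Suc i)"
  assume "sgn ?q \<in> {v i, v (Suc i)}"
  \<comment> \<open>A vector is parallel to its own \<open>sgn\<close>, so equality with an end of
    the side would make a cross product with that end vanish.\<close>
  moreover have "?q \<times> sgn ?q = 0" by (simp only: sgn_div_norm cross_mult_right cross_refl scaleR_zero_right)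
  ultimately have "?q \<times> v i = 0 \<or> ?q \<times> v (Suc i) = 0" by auto
  moreover have "v (Suc i) \<times> v i \<noteq> 0" "v i \<times> v (Suc i) \<noteq> 0"
    using side_normal_nonzero[of i] cross_skew[of "v (Suc i)" "v i"] by (auto simp: side_normal_def)
  ultimately show False using assms by (simp add: cross_add_left cross_mult_left)
qed

text \<open>Two chords of a circle of equal length, one rotated against the other by less than its
  own central angle, intersect.\<close>

lemma chords_intersect:
  assumes "0 < \<delta>" "\<delta> < \<phi>" and j: "E (j * \<phi>) = E \<delta>"
  obtains A B where "0 < A" "0 < B" "B *\<^sub>R v 0 + A *\<^sub>R v 1 = A *\<^sub>R v j + B *\<^sub>R v (Suc j)"
proof -
  \<comment> \<open>Reflection in the direction at angle \<open>p\<close> swaps the two chords, so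
    they meet on that axis. The ends of the first chord lie at angles \<open>p\<close> and
    \<open>q\<close> on either side of it, whence the weights \<open>sin q\<close> and
    \<open>sin p\<close>.\<close>
  define p q where "p = (\<phi> + \<delta>) / 2" and "q = (\<phi> - \<delta>) / 2"
  have pq: "\<phi> = p + q" "\<delta> = p - q" by (simp_all add: p_def q_def field_simps)
  have pos: "0 < sin p" "0 < sin q" using assms \<phi> by (auto simp: p_def q_def intro!: sin_gt_zero)
  have cs: "cos (j * \<phi>) = cos \<delta>" "sin (j * \<phi>) = sin \<delta>"
    using j by (metis E_inner_frame)+
  have "E (Suc j * \<phi>) = E (\<delta> + \<phi>)"
  proof -
    have "Suc j * \<phi> = j * \<phi> + \<phi>" by (simp add: distrib_right)
    then show ?thesis by (simp only: E_def cos_add sin_add cs)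
  qed
  moreover have "\<delta> + \<phi> = 2 * p" using pq by simp
  moreover have "sin q *\<^sub>R E 0 + sin p *\<^sub>R E \<phi> = sin p *\<^sub>R E \<delta> + sin q *\<^sub>R E (2 * p)"
  proof -
    have "sin q + sin p * cos \<phi> = sin p * cos \<delta> + sin q * cos (2 * p)"
      unfolding pq cos_add cos_diff cos_double_sin by (simp add: algebra_simps power2_eq_square)
    moreover have "sin p * sin \<phi> = sin p * sin \<delta> + sin q * sin (2 * p)"
      unfolding pq sin_add sin_diff sin_double by (simp add: algebra_simps power2_eq_square)
    moreover have "sin q *\<^sub>R E 0 + sin p *\<^sub>R E \<phi> =
        (sin q + sin p * cos \<phi>) *\<^sub>R e1 + (sin p * sin \<phi>) *\<^sub>R e2"
      by (simp add: E_def algebra_simps)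
    moreover have "sin p *\<^sub>R E \<delta> + sin q *\<^sub>R E (2 * p) =
        (sin p * cos \<delta> + sin q * cos (2 * p)) *\<^sub>R e1 + (sin p * sin \<delta> + sin q * sin (2 * p)) *\<^sub>R e2"
      by (simp add: E_def algebra_simps)
    ultimately show ?thesis by simp
  qed
  ultimately have *: "sin q *\<^sub>R E 0 + sin p *\<^sub>R E \<phi> = sin p *\<^sub>R E (j * \<phi>) + sin q *\<^sub>R E (Suc j * \<phi>)"
    using j by simp
  have "sin q *\<^sub>R v 0 + sin p *\<^sub>R v 1 =
      ((sin q + sin p) * h) *\<^sub>R c + s *\<^sub>R (sin q *\<^sub>R E 0 + sin p *\<^sub>R E \<phi>)"
    by (simp add: v_def algebra_simps)
  also have "\<dots> = sin p *\<^sub>R v j + sin q *\<^sub>R v (Suc j)"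
    unfolding * by (simp add: v_def algebra_simps)
  finally show ?thesis using that pos by blast
qed

end

section \<open>Excluding star polygons, and the region as an intersection of hemispheres\<close>

lemma side_mod: "side P (i mod length (vertices P)) = side P i"
  by (cases "vertices P = []") (simp_all add: side_def vertex_def mod_Suc_eq)

lemma vertex_mod: "vertex P (i mod length (vertices P)) = vertex P i"
  by (simp add: vertex_def)

text \<open>The weights need not sum to 1, because \<open>sgn\<close> discards a positive
  factor.\<close>

lemma convex_combination_in_side:
  assumes "0 \<le> \<alpha>" "0 \<le> \<beta>" "0 < \<alpha> + \<beta>"
  shows "sgn (\<alpha> *\<^sub>R vertex P i + \<beta> *\<^sub>R vertex P (Suc i)) \<in> side P i"
proof -
  have "sgn (\<alpha> *\<^sub>R vertex P i + \<beta> *\<^sub>R vertex P (Suc i)) =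
      sgn ((1 - \<beta> / (\<alpha> + \<beta>)) *\<^sub>R vertex P i + (\<beta> / (\<alpha> + \<beta>)) *\<^sub>R vertex P (Suc i))"
  proof -
    have "\<alpha> *\<^sub>R vertex P i + \<beta> *\<^sub>R vertex P (Suc i) =
      (\<alpha> + \<beta>) *\<^sub>R ((1 - \<beta> / (\<alpha> + \<beta>)) *\<^sub>R vertex P i + (\<beta> / (\<alpha> + \<beta>)) *\<^sub>R vertex P (Suc i))"
      using assms by (simp add: scaleR_add_right right_diff_distrib)
    then show ?thesis using assms by (simp only: sgn_scaleR) simp
  qed
  then show ?thesis
    using assms unfolding side_def closed_segment_def by fastforce
qed

locale regular_position_polygon = regular_position +
  fixes P :: spherical_polygon and n :: nat
  assumes polygon: "is_spherical_polygon P" and len: "length (vertices P) = n"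
    and vertex_eq: "\<And>i. vertex P i = v i"
begin

lemma n: "3 \<le> n"
  using polygon len by (simp add: is_spherical_polygon_def Let_def)

lemma sides_meet:
  assumes "i < n" "j < n" "i \<noteq> j"
  shows "side P i \<inter> side P j = {v i, v (Suc i)} \<inter> {v j, v (Suc j)}"
  using polygon assms by (simp add: is_spherical_polygon_def Let_def len vertex_eq)

lemma v_mod: "v (i mod n) = v i"
  using vertex_mod[of P i] by (simp add: len vertex_eq)

lemma v_inj:
  assumes "i < n" "j < n" "v i = v j"
  shows "i = j"
proof -
  have "distinct (vertices P)" using polygon by (simp add: is_spherical_polygon_def Let_def)
  moreover have "vertices P ! i = v i" "vertices P ! j = v j"
    using vertex_eq[of i] vertex_eq[of j] assms by (simp_all add: vertex_def len)
  ultimately show ?thesis using assms len by (metis nth_eq_iff_index_eq)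
qed

lemma v_eq_iff_E: "v i = v j \<longleftrightarrow> E (i * \<phi>) = E (j * \<phi>)"
  using s by (simp add: v_def)

lemma E_2pi: "E (2 * pi * real k + t) = E t"
  using cos_2npi[of k] sin_2npi[of k] by (simp add: E_def cos_add sin_add mult.commute mult.left_commute)

text \<open>\<open>M\<close> counts the turns around the axis before the polygon closes; each step
  turns by less than \<open>pi\<close>, which bounds it by half of \<open>n\<close>.\<close>

lemma turning_number:
  obtains M :: nat where "0 < M" "2 * M < n" "n * \<phi> = 2 * pi * M"
proof -
  have "v n = v 0" using v_mod[of n] by simp
  then have "E (n * \<phi>) = E 0" by (simp add: v_eq_iff_E)
  then have "cos (n * \<phi>) = 1" by (metis E_inner_frame(1) cos_zero)
  then obtain m :: int where m: "n * \<phi> = m * (2 * pi)" using cos_one_2pi_int by (auto simp: mult.assoc)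
  have "0 < n * \<phi>" "n * \<phi> < n * pi" using n \<phi> by auto
  then have "0 < m" "2 * real_of_int m < real n" unfolding m by (simp_all add: zero_less_mult_iff)
  then show ?thesis using that[of "nat m"] m by (simp add: mult.commute)
qed

lemma \<phi>_eq: "\<phi> = 2 * pi / n"
proof -
  obtain M where M: "0 < M" "2 * M < n" "n * \<phi> = 2 * pi * M" by (rule turning_number)
  have M': "real i * \<phi> = 2 * pi * (real (M * i) / n)" for i
    using M n by (simp add: field_simps)
  \<comment> \<open>A common factor \<open>g\<close> would bring the chain back to
    \<open>v 0\<close> after \<open>n / g\<close> steps, against distinctness of the
    vertices.\<close>
  have "gcd M n = 1"
  proof -
    define g where "g = gcd M n"
    obtain n' M' where g: "n = g * n'" "M = g * M'" unfolding g_def by (meson dvdE gcd_dvd1 gcd_dvd2)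
    have "0 < g" "0 < n'" using g(1) n by (auto intro: Nat.gr0I)
    then have "real n' * \<phi> = 2 * pi * real M'"
      unfolding M' by (simp add: g)
    then have "v n' = v 0" using E_2pi[of M' 0] by (simp add: v_eq_iff_E)
    then have "\<not> n' < n" using v_inj[of n' 0] n \<open>0 < n'\<close> by auto
    then have "g * n' \<le> 1 * n'" unfolding g(1) by linarith
    then have "g \<le> 1" using \<open>0 < n'\<close> mult_le_cancel2[of g n' 1] by blast
    then have "g = 1" using \<open>0 < g\<close> by linarith
    then show ?thesis by (simp add: g_def)
  qed
  \<comment> \<open>Inverting \<open>M\<close> modulo \<open>n\<close> produces the vertex lying at
    angle \<open>2 * pi / n\<close> from \<open>v 0\<close>. If that is less than
    \<open>\<phi>\<close>, the side starting there crosses side 0.\<close>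
  then obtain x y where xy: "M * x = n * y + 1" using bezout_nat[of M n] M by auto
  define j where "j = x mod n"
  define \<delta> where "\<delta> = 2 * pi / n"
  have "real (M * x) = real n * real y + 1" unfolding xy by simp
  then have "real x * \<phi> = 2 * pi * real y + \<delta>"
    unfolding M' using n by (simp add: \<delta>_def field_simps)
  then have Ex: "E (real x * \<phi>) = E \<delta>" using E_2pi by simp
  have vj: "v j = v x" "v (Suc j) = v (Suc x)"
    unfolding j_def using v_mod[of x] v_mod[of "Suc x"] v_mod[of "Suc (x mod n)"] by (simp_all add: mod_Suc_eq)
  then have Ej: "E (real j * \<phi>) = E \<delta>" using Ex by (simp add: v_eq_iff_E)
  have \<delta>: "0 < \<delta>" "\<delta> < pi" using n by (auto simp: \<delta>_def field_simps)
  have "\<delta> \<le> \<phi>" using M'[of 1] M n by (simp add: \<delta>_def field_simps)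
  moreover have False if less: "\<delta> < \<phi>"
  proof -
    obtain A B where AB: "0 < A" "0 < B" "B *\<^sub>R v 0 + A *\<^sub>R v 1 = A *\<^sub>R v j + B *\<^sub>R v (Suc j)"
      using chords_intersect[OF \<delta>(1) less Ej] by blast
    let ?q = "B *\<^sub>R v 0 + A *\<^sub>R v 1"
    have "sgn ?q \<in> side P 0"
      using convex_combination_in_side[of B A P 0] AB by (simp add: vertex_eq)
    moreover have "sgn ?q \<in> side P j"
      using convex_combination_in_side[of A B P j] AB by (simp add: vertex_eq)
    moreover have "j \<noteq> 0"
    proof
      assume "j = 0"
      then have "E 0 = E \<delta>" using Ej by simp
      then show False using sin_gt_zero[OF \<delta>] by (metis E_inner_frame(2) sin_zero less_irrefl)
    qed
    moreover have "j < n" using n by (simp add: j_def)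
    ultimately have "sgn ?q \<in> {v 0, v 1}" using sides_meet[of 0 j] n by auto
    then show False using sgn_combination_not_vertex[of B A 0] AB by simp
  qed
  ultimately show ?thesis by (force simp: \<delta>_def)
qed

lemma side_normal_mod: "side_normal (j mod n) = side_normal j"
  using v_mod[of j] v_mod[of "Suc j"] v_mod[of "Suc (j mod n)"]
  by (simp add: side_normal_def mod_Suc_eq)

lemma all_side_normals:
  assumes "\<And>j. j < n \<Longrightarrow> Q (side_normal j)"
  shows "Q (side_normal j)"
  using assms[of "j mod n"] n by (simp add: side_normal_mod)

text \<open>On the plane of a side, a point is a combination of the two ends. The normal of the
  preceding side forces one coefficient to be nonnegative, that of the following side the other, so
  the point lies on the arc itself.\<close>

lemma closed_cone_face_in_boundary:
  assumes nonneg: "\<And>j. j < n \<Longrightarrow> 0 \<le> x \<bullet> side_normal j" and i: "i < n" "x \<bullet> side_normal i = 0"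
    and x: "norm x = 1"
  shows "x \<in> boundary P"
proof -
  \<comment> \<open>A representative of the predecessor of \<open>i\<close> modulo \<open>n\<close>;
    adding \<open>n\<close> avoids truncated subtraction at \<open>i = 0\<close>.\<close>
  define k where "k = i + n - 1"
  have k: "Suc k mod n = i" using i n by (simp add: k_def)
  let ?p = "v (Suc k)" and ?q = "v (Suc (Suc k))" and ?r = "side_normal (Suc k)"
  have nn: "0 \<le> x \<bullet> side_normal j" for j
    using all_side_normals[of "\<lambda>w. 0 \<le> x \<bullet> w"] nonneg by blast
  have xr: "x \<bullet> ?r = 0" using i side_normal_mod[of "Suc k"] k by simp
  have r: "?r \<bullet> ?r > 0" using side_normal_nonzero by simp
  have det: "?p \<bullet> (?q \<times> ?r) = ?r \<bullet> ?r"
    unfolding side_normal_def by (metis triple_product_rotate)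
  define \<alpha> where "\<alpha> = x \<bullet> (?q \<times> ?r) / (?r \<bullet> ?r)"
  define \<beta> where "\<beta> = x \<bullet> (?r \<times> ?p) / (?r \<bullet> ?r)"
  have "x = (1 / (?r \<bullet> ?r)) *\<^sub>R ((?p \<bullet> (?q \<times> ?r)) *\<^sub>R x)" using r det by simp
  also have "\<dots> = \<alpha> *\<^sub>R ?p + \<beta> *\<^sub>R ?q"
    unfolding triple_product_decomposition[of ?p ?q ?r x]
    using xr by (simp add: \<alpha>_def \<beta>_def scaleR_add_right side_normal_def)
  finally have x_eq: "x = \<alpha> *\<^sub>R ?p + \<beta> *\<^sub>R ?q" .
  have "0 \<le> \<beta> * (?q \<bullet> side_normal k)"
    using nn[of k] unfolding x_eq by (simp add: inner_add v_inner_own_side_normal)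
  then have \<beta>: "0 \<le> \<beta>" using v_inner_next_side_normal(2)[of k] by (simp add: zero_le_mult_iff)
  have "0 \<le> \<alpha> * (?p \<bullet> side_normal (Suc (Suc k)))"
    using nn[of "Suc (Suc k)"] unfolding x_eq by (simp add: inner_add v_inner_own_side_normal)
  then have \<alpha>: "0 \<le> \<alpha>" using v_inner_next_side_normal(1)[of "Suc k"] by (simp add: zero_le_mult_iff)
  have "\<alpha> \<noteq> 0 \<or> \<beta> \<noteq> 0" using x x_eq by auto
  then have "0 < \<alpha> + \<beta>" using \<alpha> \<beta> by linarith
  then have "sgn x \<in> side P (Suc k)"
    using convex_combination_in_side[of \<alpha> \<beta> P "Suc k"] \<alpha> \<beta> by (simp add: vertex_eq flip: x_eq)
  then have "x \<in> side P i" using x side_mod[of P "Suc k"] k by (simp add: len sgn_div_norm)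
  then show ?thesis using i by (auto simp: boundary_def len)
qed

lemma side_inner_side_normal:
  assumes "x \<in> side P i" shows "x \<bullet> side_normal i = 0"
  using assms
  by (auto simp: side_def closed_segment_def vertex_eq sgn_div_norm inner_add v_inner_own_side_normal)

text \<open>Adding the half-angle formulas for both ends leaves a positive multiple of
  \<open>1 - cos (j * \<phi>)\<close>.\<close>

lemma midpoint_inner_side_normal:
  assumes "0 < j" "j < n"
  shows "0 < (v 0 + v 1) \<bullet> side_normal j"
proof -
  define x where "x = real j * \<phi>"
  have x: "0 < x / 2" "x / 2 < pi" using assms by (auto simp: x_def \<phi>_eq field_simps)
  have "0 < sin (x / 2)" using x by (rule sin_gt_zero)
  moreover have "cos x = 1 - 2 * (sin (x / 2))\<^sup>2" using cos_double_sin[of "x / 2"] by simp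
  ultimately have "cos x < 1" by simp
  moreover have "0 < cos (\<phi> / 2)" "0 < sin (\<phi> / 2)"
    using \<phi> by (auto intro!: cos_gt_zero sin_gt_zero)
  ultimately have "0 < 2 * h * s\<^sup>2 * sin (\<phi> / 2) * (2 * (cos (\<phi> / 2) * (1 - cos x)))"
    using h s by simp
  also have "\<dots> = (v 0 + v 1) \<bullet> side_normal j"
  proof -
    have "(real 0 - real j) * \<phi> - \<phi> / 2 = - (x + \<phi> / 2)" "(real 1 - real j) * \<phi> - \<phi> / 2 = - (x - \<phi> / 2)"
      by (simp_all add: x_def algebra_simps)
    then show ?thesis
      unfolding inner_add v_inner_side_normal_half by (simp add: cos_add cos_diff algebra_simps)
  qed
  finally show ?thesis .
qed

definition interior_cone :: "(real^3) set" where
  "interior_cone = {x. \<forall>j<n. 0 < x \<bullet> side_normal j}"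

lemma interior_cone_Inter: "interior_cone = (\<Inter>j\<in>{..<n}. {x. 0 < side_normal j \<bullet> x})"
  by (auto simp: interior_cone_def inner_commute)

lemma open_interior_cone: "open interior_cone"
  unfolding interior_cone_Inter by (intro open_INT) (auto simp: open_halfspace_gt)

lemma convex_interior_cone: "convex interior_cone"
  unfolding interior_cone_Inter by (intro convex_INT) (auto simp: convex_halfspace_gt)

lemma interior_cone_nonzero: "0 \<notin> interior_cone"
  using n by (auto simp: interior_cone_def intro!: exI[of _ 0])

lemma sgn_mem_interior_cone: "x \<in> interior_cone \<Longrightarrow> sgn x \<in> interior_cone"
  using interior_cone_nonzero
  by (cases "x = 0") (auto simp: interior_cone_def sgn_div_norm divide_inverse[symmetric] zero_less_mult_iff)

lemma sphere_Int_interior_cone: "sphere 0 1 \<inter> interior_cone = sgn ` interior_cone"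
proof (intro equalityI subsetI)
  fix x assume x: "x \<in> sphere 0 1 \<inter> interior_cone"
  then have "sgn x = x" by (simp add: sgn_div_norm)
  then show "x \<in> sgn ` interior_cone" using x by (metis IntD2 imageI)
next
  fix x assume "x \<in> sgn ` interior_cone"
  then show "x \<in> sphere 0 1 \<inter> interior_cone"
    using sgn_mem_interior_cone interior_cone_nonzero by (auto simp: norm_sgn)
qed

lemma connected_sphere_Int_interior_cone: "connected (sphere 0 1 \<inter> interior_cone)"
  unfolding sphere_Int_interior_cone
  using interior_cone_nonzero
  by (intro connected_continuous_image convex_connected convex_interior_cone continuous_on_sgn
      continuous_on_id) auto

lemma interior_cone_boundary_disjoint: "interior_cone \<inter> boundary P = {}"
  using side_inner_side_normal by (fastforce simp: interior_cone_def boundary_def len)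

text \<open>The midpoint of side 0 is pushed slightly to the left. The orientation condition puts it
  into the region, and being strictly left of all other sides is an open condition.\<close>

lemma region_meets_interior_cone: "region P \<inter> (sphere 0 1 \<inter> interior_cone) \<noteq> {}"
proof -
  let ?x = "sgn (v 0 + v 1)"
  have "?x \<in> side P 0" using convex_combination_in_side[of 1 1 P 0] by (simp add: vertex_eq)
  moreover have "?x \<notin> {v 0, v 1}" using sgn_combination_not_vertex[of 1 1 0] by simp
  ultimately have 1: "\<forall>\<^sub>F t in at_right 0. sgn (?x + t *\<^sub>R side_normal 0) \<in> region P"
    using polygon n by (simp add: is_spherical_polygon_def Let_def len vertex_eq side_normal_def)
  have x0: "?x \<bullet> side_normal 0 = 0" using \<open>?x \<in> side P 0\<close> by (rule side_inner_side_normal)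
  have "v 0 + v 1 \<noteq> 0" using midpoint_inner_side_normal[of 1] n by auto
  then have xj: "0 < ?x \<bullet> side_normal j" if "0 < j" "j < n" for j
    using midpoint_inner_side_normal[OF that] by (simp add: sgn_div_norm)
  have "\<forall>\<^sub>F t in at_right 0. 0 < (?x + t *\<^sub>R side_normal 0) \<bullet> side_normal j" if "j < n" for j
  proof (cases "j = 0")
    case True
    have "\<forall>\<^sub>F t in at_right (0::real). 0 < t" by (simp add: eventually_at_right_less)
    then show ?thesis
    proof eventually_elim
      case (elim t)
      then show ?case using True x0 side_normal_nonzero[of 0] by (simp add: inner_add)
    qed
  next
    case False
    have "((\<lambda>t. (?x + t *\<^sub>R side_normal 0) \<bullet> side_normal j) \<longlongrightarrow>
        (?x + 0 *\<^sub>R side_normal 0) \<bullet> side_normal j) (at_right 0)"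
      by (intro tendsto_intros)
    then show ?thesis using xj[of j] that False by (auto dest: order_tendstoD(1))
  qed
  then have 2: "\<forall>\<^sub>F t in at_right 0. \<forall>j\<in>{..<n}. 0 < (?x + t *\<^sub>R side_normal 0) \<bullet> side_normal j"
    by (intro eventually_ball_finite) auto
  obtain t where t: "sgn (?x + t *\<^sub>R side_normal 0) \<in> region P" "?x + t *\<^sub>R side_normal 0 \<in> interior_cone"
    using eventually_happens[OF eventually_conj[OF 1 2]] by (auto simp: interior_cone_def)
  then have "sgn (?x + t *\<^sub>R side_normal 0) \<in> sphere 0 1 \<inter> interior_cone"
    unfolding sphere_Int_interior_cone by blast
  then show ?thesis using t(1) by blast
qed

text \<open>The open cone meets the sphere in a connected set avoiding the boundary, so the
  component contains it. Conversely the region misses the faces of the closed cone, so the open cone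
  and the complement of the closed one would disconnect it if it left the cone.\<close>

lemma region_eq: "region P = sphere 0 1 \<inter> interior_cone"
proof -
  have comp: "region P \<in> components (sphere 0 1 - boundary P)"
    using polygon by (simp add: is_spherical_polygon_def Let_def)
  have "sphere 0 1 \<inter> interior_cone \<subseteq> region P"
    by (rule components_maximal[OF comp connected_sphere_Int_interior_cone])
       (use interior_cone_boundary_disjoint region_meets_interior_cone in auto)
  moreover have "region P \<subseteq> interior_cone"
  proof -
    let ?V = "- (\<Inter>j\<in>{..<n}. {x. side_normal j \<bullet> x \<ge> 0})"
    have "open ?V" by (intro open_Compl closed_INT) (auto simp: closed_halfspace_ge)
    moreover have "connected (region P)" using in_components_connected[OF comp] .
    moreover have "region P \<subseteq> interior_cone \<union> ?V"
    proof
      fix x assume "x \<in> region P"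
      then have x: "norm x = 1" "x \<notin> boundary P" using in_components_subset[OF comp] by auto
      show "x \<in> interior_cone \<union> ?V"
        using closed_cone_face_in_boundary[of x] x
        by (fastforce simp: interior_cone_def inner_commute less_le)
    qed
    moreover have "interior_cone \<inter> ?V \<inter> region P = {}"
      by (auto simp: interior_cone_Inter intro: less_imp_le)
    ultimately have "interior_cone \<inter> region P = {} \<or> ?V \<inter> region P = {}"
      using connectedD open_interior_cone by blast
    then show ?thesis using region_meets_interior_cone \<open>region P \<subseteq> interior_cone \<union> ?V\<close> by blast
  qed
  moreover have "region P \<subseteq> sphere 0 1" using in_components_subset[OF comp] by auto
  ultimately show ?thesis by blast
qed

end

section \<open>Area and perimeter of a regular polygon\<close>

lemma sgn_inner_sgn: "sgn p \<bullet> sgn q = p \<bullet> q / (norm p * norm q)"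
  by (simp add: sgn_div_norm field_simps)

lemma ball_cone_sgn: "ball_cone (sgn ` A) = ball_cone A"
proof -
  have "0 \<le> sgn p \<bullet> x \<longleftrightarrow> 0 \<le> p \<bullet> x" for p x :: "real^3"
    by (cases "p = 0") (auto simp: sgn_div_norm zero_le_mult_iff)
  then show ?thesis by (auto simp: ball_cone_def)
qed

lemma measure_ball_cone_triple_nonzero:
  assumes "p \<noteq> 0" "q \<noteq> 0" "r \<noteq> 0"
  shows "3 * measure lebesgue (ball_cone {p, q, r}) = 2 * pi - arccos (p \<bullet> q / (norm p * norm q)) -
    arccos (q \<bullet> r / (norm q * norm r)) - arccos (r \<bullet> p / (norm r * norm p))"
  using measure_ball_cone_triple[of "sgn p" "sgn q" "sgn r"] assms ball_cone_sgn[of "{p, q, r}"]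
  by (simp add: norm_sgn sgn_inner_sgn)

lemma cos_le_cos_of_le_of_le:
  assumes "0 \<le> x" "x \<le> \<bar>y\<bar>" "\<bar>y\<bar> \<le> 2 * pi - x"
  shows "cos y \<le> cos x"
proof (cases "\<bar>y\<bar> \<le> pi")
  case True
  then show ?thesis using cos_monotone_0_pi_le[of x "\<bar>y\<bar>"] assms by simp
next
  case False
  have "cos y = cos (2 * pi - \<bar>y\<bar>)" by (simp add: cos_diff)
  then show ?thesis using cos_monotone_0_pi_le[of x "2 * pi - \<bar>y\<bar>"] assms False by simp
qed

section \<open>Dissection into triangles around the centre\<close>

context regular_position_polygon
begin

lemma n_\<phi>: "n * \<phi> = 2 * pi"
  using n by (simp add: \<phi>_eq)

text \<open>No vertex is closer than \<open>\<phi> / 2\<close> in angle to the midpoint of a side.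
  The case \<open>i = n\<close> is included for the successor of the last vertex.\<close>

lemma v_inner_side_normal_nonneg:
  assumes "i \<le> n" "j < n"
  shows "0 \<le> v i \<bullet> side_normal j"
proof -
  let ?y = "(real i - real j) * \<phi> - \<phi> / 2"
  have "\<phi> / 2 \<le> \<bar>?y\<bar> \<and> \<bar>?y\<bar> \<le> 2 * pi - \<phi> / 2"
  proof (cases "j < i")
    case True
    then have "1 * \<phi> \<le> (real i - real j) * \<phi>" "(real i - real j) * \<phi> \<le> n * \<phi>"
      using assms \<phi> by (auto intro!: mult_right_mono)
    then show ?thesis using \<phi> n_\<phi> by auto
  next
    case False
    then have "0 \<le> (real j - real i) * \<phi>" "(real j - real i) * \<phi> \<le> (real n - 1) * \<phi>"
      using assms \<phi> by (auto intro!: mult_right_mono)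
    moreover have "?y = - ((real j - real i) * \<phi> + \<phi> / 2)" "(real n - 1) * \<phi> = 2 * pi - \<phi>"
      using n_\<phi> by (simp_all add: algebra_simps)
    ultimately show ?thesis using \<phi> by auto
  qed
  then have "cos ?y \<le> cos (\<phi> / 2)" using \<phi> by (intro cos_le_cos_of_le_of_le) auto
  moreover have "0 < sin (\<phi> / 2)" using \<phi> by (intro sin_gt_zero) auto
  ultimately show ?thesis using h by (simp add: v_inner_side_normal_half)
qed

text \<open>The solid cone over the spherical triangle with corners \<open>c\<close>,
  \<open>v i\<close> and \<open>v (Suc i)\<close>, given by the inward normals of its three
  faces.\<close>

definition triangle_cone :: "nat \<Rightarrow> (real^3) set" where
  "triangle_cone i = ball_cone {side_normal i, c \<times> v i, v (Suc i) \<times> c}"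

lemma inner_c_cross_v: "(z *\<^sub>R c + r *\<^sub>R E \<psi>) \<bullet> (c \<times> v i) = r * s * sin (\<psi> - i * \<phi>)"
  by (simp add: v_def inner_add cross_add_right cross_mult_right E_inner_c_cross_E dot_cross_self)

lemma c_cross_v_nonzero: "c \<times> v i \<noteq> 0"
proof
  assume "c \<times> v i = 0"
  then have "(0 *\<^sub>R c + 1 *\<^sub>R E (i * \<phi> + pi / 2)) \<bullet> (c \<times> v i) = 0" by simp
  then show False unfolding inner_c_cross_v using s by simp
qed

text \<open>By Cramer's rule a point of the triangle cone is a nonnegative combination of the three
  corners, and no corner lies to the right of a side.\<close>

lemma triangle_cone_subset:
  assumes "i < n"
  shows "triangle_cone i \<subseteq> ball_cone (side_normal ` {..<n})"
proof
  fix y assume y: "y \<in> triangle_cone i"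
  then have pos: "0 \<le> y \<bullet> side_normal i" "0 \<le> y \<bullet> (c \<times> v i)" "0 \<le> y \<bullet> (v (Suc i) \<times> c)"
    by (auto simp: triangle_cone_def ball_cone_def inner_commute)
  have "0 \<le> y \<bullet> side_normal j" if "j < n" for j
  proof -
    have "(c \<bullet> side_normal i) * (y \<bullet> side_normal j) =
        (y \<bullet> side_normal i) * (c \<bullet> side_normal j) + (y \<bullet> (v (Suc i) \<times> c)) * (v i \<bullet> side_normal j)
        + (y \<bullet> (c \<times> v i)) * (v (Suc i) \<bullet> side_normal j)"
      using arg_cong[OF triple_product_decomposition[of c "v i" "v (Suc i)" y],
          of "\<lambda>x. x \<bullet> side_normal j"]
      by (simp add: inner_add side_normal_def[of i])
    also have "\<dots> \<ge> 0"
      using pos v_inner_side_normal_nonneg[of i j] v_inner_side_normal_nonneg[of "Suc i" j]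
        c_inner_side_normal_pos[of j] assms that
      by (intro add_nonneg_nonneg mult_nonneg_nonneg) auto
    finally show ?thesis using c_inner_side_normal_pos[of i] by (simp add: zero_le_mult_iff)
  qed
  then show "y \<in> ball_cone (side_normal ` {..<n})"
    using y by (auto simp: triangle_cone_def ball_cone_def inner_commute)
qed

lemma ball_cone_side_normals_eq: "ball_cone (side_normal ` {..<n}) = (\<Union>i\<in>{..<n}. triangle_cone i)"
proof (intro equalityI subsetI)
  fix y assume y: "y \<in> ball_cone (side_normal ` {..<n})"
  obtain r \<psi> z where cyl: "0 \<le> r" "0 \<le> \<psi>" "\<psi> < 2 * pi" "y = z *\<^sub>R c + r *\<^sub>R E \<psi>"
    by (rule cylindrical)
  \<comment> \<open>The triangle is found from the sector of width \<open>\<phi>\<close> that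
    contains the azimuth of the point.\<close>
  define i where "i = nat \<lfloor>\<psi> / \<phi>\<rfloor>"
  have "real i = of_int \<lfloor>\<psi> / \<phi>\<rfloor>" using cyl \<phi> by (simp add: i_def)
  then have "real i \<le> \<psi> / \<phi>" "\<psi> / \<phi> < real i + 1" by linarith+
  then have i: "i * \<phi> \<le> \<psi>" "\<psi> < Suc i * \<phi>" using \<phi> by (simp_all add: field_simps)
  have "i * \<phi> < n * \<phi>" using i(1) cyl(3) n_\<phi> by linarith
  then have "i < n" using \<phi> by simp
  have "0 \<le> y \<bullet> (c \<times> v i)"
    unfolding cyl(4) inner_c_cross_v
    using cyl s i \<phi> by (intro mult_nonneg_nonneg sin_ge_zero) (auto simp: algebra_simps)
  moreover have "0 \<le> y \<bullet> (v (Suc i) \<times> c)"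
  proof -
    have "0 \<le> r * s * sin (Suc i * \<phi> - \<psi>)"
      using cyl s i \<phi> by (intro mult_nonneg_nonneg sin_ge_zero) (auto simp: algebra_simps)
    also have "\<dots> = - (r * s * sin (\<psi> - Suc i * \<phi>))"
      using sin_minus[of "\<psi> - Suc i * \<phi>"] by simp
    also have "\<dots> = y \<bullet> (v (Suc i) \<times> c)"
      using inner_c_cross_v[of z r \<psi> "Suc i"] cross_skew[of "v (Suc i)" c] by (simp add: cyl(4))
    finally show ?thesis .
  qed
  ultimately have "y \<in> triangle_cone i"
    using y \<open>i < n\<close> by (auto simp: triangle_cone_def ball_cone_def inner_commute)
  then show "y \<in> (\<Union>i\<in>{..<n}. triangle_cone i)" using \<open>i < n\<close> by blast
qed (use triangle_cone_subset in blast)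

text \<open>The sine conditions fix the azimuth only modulo a full turn; the ranges of
  \<open>\<psi>\<close> and \<open>i\<close> rule out the other representatives.\<close>

lemma sector_bounds:
  assumes \<psi>: "0 \<le> \<psi>" "\<psi> < 2 * pi" and i: "i < n"
    and sin: "0 < sin (\<psi> - i * \<phi>)" "0 < sin (Suc i * \<phi> - \<psi>)"
  shows "i * \<phi> < \<psi>" "\<psi> < Suc i * \<phi>"
proof -
  define \<delta> where "\<delta> = \<psi> - i * \<phi>"
  have sin\<delta>: "0 < sin \<delta>" "sin (\<delta> - \<phi>) < 0"
    using sin sin_minus[of "\<delta> - \<phi>"] by (simp_all add: \<delta>_def algebra_simps)
  have "(real i + 1) * \<phi> \<le> n * \<phi>" using i \<phi> by (intro mult_right_mono) auto
  then have "real i * \<phi> \<le> 2 * pi - \<phi>" using n_\<phi> by (simp add: algebra_simps)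
  moreover have "0 \<le> real i * \<phi>" using \<phi> by simp
  ultimately have \<delta>: "\<phi> - 2 * pi \<le> \<delta>" "\<delta> < 2 * pi" using \<psi> by (auto simp: \<delta>_def)
  have "0 < \<delta>"
  proof (rule ccontr)
    assume "\<not> 0 < \<delta>"
    moreover have "sin (- \<delta>) < 0" using sin\<delta> by simp
    ultimately have "pi < - \<delta>" using sin_ge_zero[of "- \<delta>"] by linarith
    then have "0 \<le> sin (\<delta> - \<phi> + 2 * pi)" using \<delta> \<phi> by (intro sin_ge_zero) auto
    then show False using sin\<delta> by simp
  qed
  moreover have "\<delta> < pi"
    using sin_le_zero[of \<delta>] \<delta> sin\<delta> by linarith
  moreover have "\<delta> < \<phi>"
    using sin_ge_zero[of "\<delta> - \<phi>"] \<open>\<delta> < pi\<close> \<phi> sin\<delta> by linarith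
  ultimately show "i * \<phi> < \<psi>" "\<psi> < Suc i * \<phi>" by (simp_all add: \<delta>_def algebra_simps)
qed

text \<open>Away from the finitely many planes through the axis and a vertex, the azimuth lies
  strictly inside the sector of any triangle containing the point, and distinct open sectors are
  disjoint.\<close>

lemma triangle_cones_overlap:
  assumes ij: "i < n" "j < n" "i \<noteq> j"
  shows "negligible (triangle_cone i \<inter> triangle_cone j)"
proof (rule negligible_subset)
  show "negligible (\<Union>k\<in>{..n}. {y. (c \<times> v k) \<bullet> y = 0})"
    by (intro negligible_Union finite_imageI finite_atMost) (use c_cross_v_nonzero in \<open>auto simp: negligible_hyperplane\<close>)
  show "triangle_cone i \<inter> triangle_cone j \<subseteq> (\<Union>k\<in>{..n}. {y. (c \<times> v k) \<bullet> y = 0})"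
  proof (rule ccontr)
    assume "\<not> ?thesis"
    then obtain y where y: "y \<in> triangle_cone i" "y \<in> triangle_cone j"
      "\<And>k. k \<le> n \<Longrightarrow> y \<bullet> (c \<times> v k) \<noteq> 0" by (auto simp: inner_commute)
    obtain r \<psi> z where cyl: "0 \<le> r" "0 \<le> \<psi>" "\<psi> < 2 * pi" "y = z *\<^sub>R c + r *\<^sub>R E \<psi>"
      by (rule cylindrical)
    have "i' * \<phi> < \<psi> \<and> \<psi> < Suc i' * \<phi>" if i': "i' < n" "y \<in> triangle_cone i'" for i'
    proof -
      have "0 < y \<bullet> (c \<times> v i')" "0 < - (y \<bullet> (c \<times> v (Suc i')))"
        using y(3)[of i'] y(3)[of "Suc i'"] i' cross_skew[of "v (Suc i')" c]
        by (auto simp: triangle_cone_def ball_cone_def inner_commute less_le)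
      then have "0 < r * s * sin (\<psi> - i' * \<phi>)" "0 < r * s * - sin (\<psi> - Suc i' * \<phi>)"
        unfolding cyl(4) inner_c_cross_v by simp_all
      then have "0 < sin (\<psi> - i' * \<phi>)" "0 < - sin (\<psi> - Suc i' * \<phi>)"
        using cyl(1) s by (auto simp: zero_less_mult_iff mult_less_0_iff)
      then show ?thesis
        using sector_bounds[OF cyl(2,3) i'(1)] sin_minus[of "\<psi> - Suc i' * \<phi>"] by simp
    qed
    then have "i * \<phi> < \<psi>" "\<psi> < Suc i * \<phi>" "j * \<phi> < \<psi>" "\<psi> < Suc j * \<phi>" using y ij by blast+
    then have "i * \<phi> < Suc j * \<phi>" "j * \<phi> < Suc i * \<phi>" by linarith+
    then show False using \<phi> ij by simp
  qed
qed

text \<open>The Euclidean distance from the origin to the midpoint of a chord, i.e. the cosine of half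
  the side length.\<close>

definition T :: real where
  "T = sqrt (1 - (s * sin (\<phi> / 2))\<^sup>2)"

lemma sin_half_\<phi>: "0 < sin (\<phi> / 2)" "sin (\<phi> / 2) < 1"
  and cos_half_\<phi>: "0 < cos (\<phi> / 2)"
proof -
  show "0 < sin (\<phi> / 2)" "0 < cos (\<phi> / 2)" using \<phi> by (auto intro: sin_gt_zero cos_gt_zero)
  show "sin (\<phi> / 2) < 1" using sin_monotone_2pi[of "\<phi> / 2" "pi / 2"] \<phi> by simp
qed

lemma T2: "T\<^sup>2 = 1 - s\<^sup>2 * (sin (\<phi> / 2))\<^sup>2" and T: "0 < T" "T < 1"
  and T2': "T\<^sup>2 = (cos (\<phi> / 2))\<^sup>2 + h\<^sup>2 * (sin (\<phi> / 2))\<^sup>2"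
proof -
  have "s\<^sup>2 < 1" using h hs by (metis add.commute less_add_same_cancel1 zero_less_power)
  moreover have "(sin (\<phi> / 2))\<^sup>2 < 1" using sin_half_\<phi> by (simp add: power_less_one_iff)
  ultimately have "s\<^sup>2 * (sin (\<phi> / 2))\<^sup>2 < 1 * 1"
    using s by (intro mult_strict_mono) auto
  then have *: "0 < 1 - (s * sin (\<phi> / 2))\<^sup>2" by (simp add: power_mult_distrib)
  then show "0 < T" by (simp add: T_def)
  show "T < 1" using s sin_half_\<phi> by (simp add: T_def)
  show T2: "T\<^sup>2 = 1 - s\<^sup>2 * (sin (\<phi> / 2))\<^sup>2" using * by (simp add: T_def power_mult_distrib)
  have h2: "h\<^sup>2 = 1 - s\<^sup>2" using hs by simp
  show "T\<^sup>2 = (cos (\<phi> / 2))\<^sup>2 + h\<^sup>2 * (sin (\<phi> / 2))\<^sup>2"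
    unfolding T2 h2 cos_squared_eq by (simp add: algebra_simps)
qed

lemma v_inner_step_T: "v i \<bullet> v (Suc i) = 2 * T\<^sup>2 - 1"
  and one_minus_step: "1 - v i \<bullet> v (Suc i) = 2 * s\<^sup>2 * (sin (\<phi> / 2))\<^sup>2"
proof -
  have 1: "cos \<phi> = 1 - 2 * (sin (\<phi> / 2))\<^sup>2" using cos_double_sin[of "\<phi> / 2"] by simp
  have 2: "h\<^sup>2 = 1 - s\<^sup>2" using hs by simp
  show "v i \<bullet> v (Suc i) = 2 * T\<^sup>2 - 1" "1 - v i \<bullet> v (Suc i) = 2 * s\<^sup>2 * (sin (\<phi> / 2))\<^sup>2"
    unfolding v_inner_step T2 1 2 by (simp_all add: algebra_simps)
qed

text \<open>The sine of the side length in double-angle form: \<open>s * sin (\<phi> / 2)\<close>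
  and \<open>T\<close> are the sine and cosine of half the side.\<close>

lemma norm_side_normal: "norm (side_normal i) = 2 * s * sin (\<phi> / 2) * T"
proof (rule power2_eq_imp_eq)
  have "(norm (side_normal i))\<^sup>2 = 1 - (v i \<bullet> v (Suc i))\<^sup>2"
    by (simp add: side_normal_def norm_cross norm_v)
  also have "\<dots> = (1 - v i \<bullet> v (Suc i)) * (1 + v i \<bullet> v (Suc i))"
    by (simp add: algebra_simps power2_eq_square)
  also have "\<dots> = (2 * s\<^sup>2 * (sin (\<phi> / 2))\<^sup>2) * (2 * T\<^sup>2)"
    unfolding one_minus_step unfolding v_inner_step_T by simp
  finally show "(norm (side_normal i))\<^sup>2 = (2 * s * sin (\<phi> / 2) * T)\<^sup>2"
    by (simp add: power_mult_distrib)
qed (use s sin_half_\<phi> T in auto)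

lemma norm_c_cross_v: "norm (c \<times> v i) = s"
proof (rule power2_eq_imp_eq)
  have "norm c = 1" by (simp add: norm_eq_1 frame_inner)
  then show "(norm (c \<times> v i))\<^sup>2 = s\<^sup>2"
    using hs by (simp add: norm_cross c_inner_v norm_v)
qed (use s in auto)

text \<open>The base angle by Napier's rule: \<open>h / T\<close> is the cosine of the inradius, and
  its product with the sine of the half apex angle is the cosine of the base angle.\<close>

definition \<beta> :: real where
  "\<beta> = arccos (h * sin (\<phi> / 2) / T)"

lemma cos_\<beta>: "cos \<beta> = h * sin (\<phi> / 2) / T" and sin_\<beta>: "sin \<beta> = cos (\<phi> / 2) / T"
  and \<beta>_bounds: "0 < \<beta>" "\<beta> < pi / 2"
proof -
  define u where "u = h * sin (\<phi> / 2) / T"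
  have u0: "0 < u" using h sin_half_\<phi> T by (simp add: u_def)
  have w0: "0 < cos (\<phi> / 2) / T" using cos_half_\<phi> T by simp
  have "u\<^sup>2 + (cos (\<phi> / 2) / T)\<^sup>2 = ((cos (\<phi> / 2))\<^sup>2 + h\<^sup>2 * (sin (\<phi> / 2))\<^sup>2) / T\<^sup>2"
    by (simp add: u_def power_divide power_mult_distrib add_divide_distrib)
  also have "\<dots> = 1" unfolding T2'[symmetric] using T by simp
  finally have u2: "u\<^sup>2 + (cos (\<phi> / 2) / T)\<^sup>2 = 1" .
  have u1: "u < 1" using abs_square_less_1[of u] u2 zero_less_power[OF w0, of 2] by linarith
  have \<beta>: "\<beta> = arccos u" by (simp add: \<beta>_def u_def)
  have cos: "cos \<beta> = u" unfolding \<beta> using u0 u1 by (intro cos_arccos) auto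
  then show "cos \<beta> = h * sin (\<phi> / 2) / T" by (simp add: u_def)
  show \<beta>_bounds: "0 < \<beta>" "\<beta> < pi / 2"
    unfolding \<beta> using u0 u1 arccos_less_arccos[of u 1] arccos_less_arccos[of 0 u] by auto
  have sin0: "0 < sin \<beta>" using \<beta>_bounds by (intro sin_gt_zero) linarith+
  have "(sin \<beta>)\<^sup>2 = (cos (\<phi> / 2) / T)\<^sup>2"
    using u2 sin_cos_squared_add[of \<beta>] unfolding cos by linarith
  then show "sin \<beta> = cos (\<phi> / 2) / T"
    by (rule power2_eq_imp_eq[OF _ less_imp_le[OF sin0] less_imp_le[OF w0]])
qed

text \<open>The inward face normals have inner products minus the cosines of the triangle's angles
  after normalisation, so Girard's formula applies with angles \<open>\<phi>\<close>,
  \<open>\<beta>\<close>, \<open>\<beta>\<close>.\<close>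

lemma measure_triangle_cone: "3 * measure lebesgue (triangle_cone i) = \<phi> + 2 * \<beta> - pi"
proof -
  have swap: "v (Suc i) \<times> c = - (c \<times> v (Suc i))" by (rule cross_skew)
  have norms: "norm (v (Suc i) \<times> c) = s" unfolding swap by (simp add: norm_c_cross_v)
  have vv: "v j \<bullet> v j = 1" for j using norm_v by (simp add: norm_eq_1)
  have base: "- (h * (1 - v i \<bullet> v (Suc i))) / (2 * s * sin (\<phi> / 2) * T * s) = - cos \<beta>"
    unfolding cos_\<beta> one_minus_step using s sin_half_\<phi> T by (simp add: field_simps power2_eq_square)
  have "(c \<times> v i) \<bullet> (v (Suc i) \<times> c) = - (s\<^sup>2 * cos \<phi>)"
    by (simp add: dot_cross c_inner_v frame_inner v_inner_step power2_eq_square)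
  then have apex: "(c \<times> v i) \<bullet> (v (Suc i) \<times> c) / (norm (c \<times> v i) * norm (v (Suc i) \<times> c)) = - cos \<phi>"
    using s by (simp add: norms norm_c_cross_v power2_eq_square)
  have "side_normal i \<bullet> (c \<times> v i) = - (h * (1 - v i \<bullet> v (Suc i)))"
    by (simp add: side_normal_def dot_cross c_inner_v vv inner_commute[of "v (Suc i)" "v i"] algebra_simps)
  then have base1: "side_normal i \<bullet> (c \<times> v i) / (norm (side_normal i) * norm (c \<times> v i)) = - cos \<beta>"
    unfolding norm_side_normal norm_c_cross_v using base by simp
  have "(v (Suc i) \<times> c) \<bullet> side_normal i = - (h * (1 - v i \<bullet> v (Suc i)))"
    by (simp add: side_normal_def dot_cross c_inner_v vv inner_commute[of "v (Suc i)" "v i"] algebra_simps)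
  then have base2: "(v (Suc i) \<times> c) \<bullet> side_normal i / (norm (v (Suc i) \<times> c) * norm (side_normal i)) = - cos \<beta>"
    unfolding norm_side_normal norms using base by (simp add: mult.commute)
  have nz: "v (Suc i) \<times> c \<noteq> 0" unfolding swap using c_cross_v_nonzero by simp
  have "arccos (- cos \<beta>) = pi - \<beta>" "arccos (- cos \<phi>) = pi - \<phi>"
    using \<beta>_bounds \<phi> by (simp_all add: arccos_minus arccos_cos)
  then show ?thesis
    using measure_ball_cone_triple_nonzero[OF side_normal_nonzero c_cross_v_nonzero nz, of i i]
    unfolding triangle_cone_def apex base1 base2 by simp
qed

text \<open>The solid cone over the open region differs from the closed cone only within the planes
  of the sides, a null set; the triangle cones then add up.\<close>

lemma area_eq: "area P = n * (\<phi> + 2 * \<beta> - pi)"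
proof -
  let ?K = "{t *\<^sub>R x | t x. 0 \<le> t \<and> t \<le> 1 \<and> x \<in> region P}"
  let ?B = "ball_cone (side_normal ` {..<n})"
  have "?K \<subseteq> ?B"
  proof
    fix y assume "y \<in> ?K"
    then obtain t x where y: "y = t *\<^sub>R x" and t: "0 \<le> t" "t \<le> 1" and "x \<in> region P" by blast
    then have x: "norm x = 1" "\<And>j. j < n \<Longrightarrow> 0 < x \<bullet> side_normal j"
      by (simp_all add: region_eq interior_cone_def)
    then have "0 \<le> side_normal j \<bullet> y" if "j < n" for j
      using t that unfolding y by (simp add: inner_commute less_imp_le)
    then show "y \<in> ?B" using t x by (simp add: ball_cone_def y)
  qed
  then have sub: "?K - ?B = {}" by blast
  have "?B - ?K \<subseteq> (\<Union>j\<in>{..<n}. {y. side_normal j \<bullet> y = 0})"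
  proof
    fix y assume y: "y \<in> ?B - ?K"
    show "y \<in> (\<Union>j\<in>{..<n}. {y. side_normal j \<bullet> y = 0})"
    proof (rule ccontr)
      assume "\<not> ?thesis"
      then have "side_normal j \<bullet> y \<noteq> 0" if "j < n" for j using that by blast
      moreover have "0 \<le> side_normal j \<bullet> y" if "j < n" for j using y that by (simp add: ball_cone_def)
      ultimately have "y \<in> interior_cone"
        unfolding interior_cone_def by (simp add: inner_commute[of y] less_le)
      then have "sgn y \<in> region P" unfolding region_eq sphere_Int_interior_cone by blast
      moreover have "y = norm y *\<^sub>R sgn y" by (cases "y = 0") (simp_all add: sgn_div_norm)
      moreover have "norm y \<le> 1" using y by (simp add: ball_cone_def)
      ultimately have "y = norm y *\<^sub>R sgn y \<and> 0 \<le> norm y \<and> norm y \<le> 1 \<and> sgn y \<in> region P"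
        by (intro conjI norm_ge_zero)
      then have "y \<in> ?K" by blast
      then show False using y by blast
    qed
  qed
  moreover have "negligible (\<Union>j\<in>{..<n}. {y. side_normal j \<bullet> y = 0})"
    by (intro negligible_Union finite_imageI finite_lessThan) (use side_normal_nonzero in \<open>auto simp: negligible_hyperplane\<close>)
  ultimately have "negligible (?B - ?K)" by (rule negligible_subset[rotated])
  then have "negligible (?B - ?K \<union> (?K - ?B))" unfolding sub by simp
  then have "measure lebesgue ?K = measure lebesgue ?B"
    by (rule measure_negligible_symdiff[OF lmeasurable_ball_cone])
  also have "\<dots> = (\<Sum>i<n. measure lebesgue (triangle_cone i))"
    unfolding ball_cone_side_normals_eq
  proof (rule measure_negligible_finite_Union_image)
    show "pairwise (\<lambda>i j. negligible (triangle_cone i \<inter> triangle_cone j)) {..<n}"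
      by (rule pairwiseI) (simp add: triangle_cones_overlap)
  qed (simp_all add: triangle_cone_def)
  finally have "area P = (\<Sum>i<n. 3 * measure lebesgue (triangle_cone i))"
    by (simp add: area_def sphere_area_def sum_distrib_left)
  then show ?thesis by (simp add: measure_triangle_cone)
qed

lemma \<beta>_eq: "\<beta> = base_angle n (area P)"
  using n unfolding base_angle_def area_eq by (simp add: \<phi>_eq field_simps)

text \<open>Since \<open>T < 1\<close>, the sine of \<open>\<beta>\<close> exceeds
  \<open>cos (\<phi> / 2)\<close>, the sine of the Euclidean base angle. The upper bound expresses
  \<open>\<beta> < pi / 2\<close>.\<close>

lemma area_bounds: "0 < area P" "area P < 2 * pi"
proof -
  have "cos (\<phi> / 2) < sin \<beta>"
    unfolding sin_\<beta> using T cos_half_\<phi> by (simp add: field_simps)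
  then have "sin (base_angle n 0) < sin \<beta>" unfolding sin_base_angle_0 by (simp add: \<phi>_eq)
  moreover have "sin \<beta> \<le> sin (base_angle n 0)" if "\<beta> \<le> base_angle n 0"
    using that \<beta>_bounds base_angle_bounds[of n 0] n by (intro sin_monotone_2pi_le) auto
  ultimately have "base_angle n 0 < \<beta>" by linarith
  then show "0 < area P" using n unfolding \<beta>_eq by (simp add: base_angle_def zero_less_divide_iff)
  have "area P = 2 * pi + 2 * n * (\<beta> - pi / 2)" using n_\<phi> by (simp add: area_eq algebra_simps)
  moreover have "2 * n * (\<beta> - pi / 2) < 0" using \<beta>_bounds n by (simp add: mult_less_0_iff)
  ultimately show "area P < 2 * pi" by linarith
qed

lemma perim_eq: "perim P = perim_of_area n (area P)"
proof -
  have "cos (pi / n) / sin \<beta> = T"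
    unfolding sin_\<beta> using cos_half_\<phi> T by (simp add: \<phi>_eq)
  \<comment> \<open>As \<open>T\<close> lies between 0 and 1, the doubled angle stays within the
    range of arccos.\<close>
  moreover have "arccos (2 * T\<^sup>2 - 1) = 2 * arccos T"
  proof -
    have "cos (2 * arccos T) = 2 * T\<^sup>2 - 1" using T by (simp add: cos_double_cos)
    moreover have "0 \<le> arccos T" using T by (intro arccos_lbound) auto
    moreover have "arccos T \<le> pi / 2" by (rule arccos_le_pi2) (use T in auto)
    ultimately show ?thesis using arccos_cos[of "2 * arccos T"] by simp
  qed
  ultimately show ?thesis
    by (simp add: perim_def len side_length_def vertex_eq v_inner_step_T perim_of_area_def \<beta>_eq[symmetric])
qed

end

section \<open>From equal sides and angles to regular position\<close>

lemma complex_inner_triple_norm: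
  fixes p u w :: "real^3"
  assumes "norm p = 1" "p \<bullet> u = 0" "p \<bullet> w = 0"
  shows "cmod (Complex (u \<bullet> w) (p \<bullet> (u \<times> w))) = norm u * norm w"
proof (rule power2_eq_imp_eq)
  let ?X = "u \<times> w"
  \<comment> \<open>Both vectors are tangent at \<open>p\<close>, so their cross product is a
    multiple of \<open>p\<close> and its inner product with \<open>p\<close> is its norm up to
    sign.\<close>
  have "p \<times> ?X = 0" using assms by (simp add: Lagrange)
  moreover have "p \<times> (p \<times> ?X) = (p \<bullet> ?X) *\<^sub>R p - ?X"
    using Lagrange[of p p ?X] assms(1) by (simp add: norm_eq_1)
  ultimately have "?X = (p \<bullet> ?X) *\<^sub>R p" by simp
  then have "norm ?X = \<bar>p \<bullet> ?X\<bar>" using assms(1) by (metis mult.right_neutral norm_scaleR)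
  then have "(p \<bullet> ?X)\<^sup>2 + (u \<bullet> w)\<^sup>2 = (norm u * norm w)\<^sup>2"
    using norm_cross_dot[of u w] by simp
  then show "(cmod (Complex (u \<bullet> w) (p \<bullet> ?X)))\<^sup>2 = (norm u * norm w)\<^sup>2"
    by (simp add: cmod_power2)
qed auto

text \<open>Writing the complex number behind \<open>interior_angle\<close> in polar form separates
  cosine and sine of the angle. The cosine part is the spherical law of cosines; \<open>a\<close>
  avoids 1 and -1 as neighbours are neither equal nor antipodal.\<close>

lemma regular_ngon_angle:
  assumes P: "regular_ngon n P"
  obtains a \<theta> where "\<And>i. norm (vertex P i) = 1" "\<And>i. vertex P i \<bullet> vertex P (Suc i) = a"
    "\<bar>a\<bar> < 1" "0 \<le> \<theta>" "\<theta> < pi"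
    "\<And>i. vertex P i \<bullet> vertex P (Suc (Suc i)) = a\<^sup>2 + (1 - a\<^sup>2) * cos \<theta>"
    "\<And>i. vertex P i \<bullet> (vertex P (Suc i) \<times> vertex P (Suc (Suc i))) = (1 - a\<^sup>2) * sin \<theta>"
proof -
  have len: "length (vertices P) = n" and poly: "is_spherical_polygon P"
    using P by (simp_all add: regular_ngon_def)
  have n: "3 \<le> n" and dist: "distinct (vertices P)" and sub: "set (vertices P) \<subseteq> sphere 0 1"
    and anti: "\<And>i. i < n \<Longrightarrow> vertex P (Suc i) \<noteq> - vertex P i"
    using poly by (simp_all add: is_spherical_polygon_def Let_def len)
  obtain l \<theta> where l: "\<And>i. i < n \<Longrightarrow> side_length P i = l"
    and \<theta>: "\<theta> < pi" "\<And>i. i < n \<Longrightarrow> interior_angle P i = \<theta>"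
    using P by (auto simp: regular_ngon_def)
  have period: "vertex P (i mod n) = vertex P i" "vertex P (Suc (i mod n)) = vertex P (Suc i)" for i
    using vertex_mod[of P i] vertex_mod[of P "Suc i"] vertex_mod[of P "Suc (i mod n)"]
    by (simp_all add: len mod_Suc_eq)
  have unit: "norm (vertex P i) = 1" for i
  proof -
    have "vertex P i \<in> set (vertices P)" using n by (simp add: vertex_def len)
    then show ?thesis using sub by auto
  qed
  have bound: "\<bar>vertex P i \<bullet> vertex P j\<bar> \<le> 1" for i j
    using Cauchy_Schwarz_ineq2[of "vertex P i" "vertex P j"] unit by simp
  define a where "a = cos l"
  have step: "vertex P i \<bullet> vertex P (Suc i) = a" for i
  proof -
    have "arccos (vertex P i \<bullet> vertex P (Suc i)) = l"
      using l[of "i mod n"] n by (simp add: side_length_def period)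
    then show ?thesis using bound[of i "Suc i"] by (metis a_def cos_arccos_abs)
  qed
  have "vertex P 0 \<noteq> vertex P 1" using dist n by (simp add: vertex_def len nth_eq_iff_index_eq)
  then have "a < 1" using unit_inner_less_1[of "vertex P 0" "vertex P 1"] unit step[of 0] by simp
  moreover have "vertex P 0 \<noteq> - vertex P 1" using anti[of 0] n by (metis One_nat_def minus_minus not_numeral_le_zero gr0I)
  then have "- a < 1" using unit_inner_less_1[of "vertex P 0" "- vertex P 1"] unit step[of 0] by simp
  ultimately have a: "\<bar>a\<bar> < 1" by simp
  have angle: "vertex P i \<bullet> vertex P (Suc (Suc i)) - a\<^sup>2 = (1 - a\<^sup>2) * cos \<theta> \<and>
      vertex P i \<bullet> (vertex P (Suc i) \<times> vertex P (Suc (Suc i))) = (1 - a\<^sup>2) * sin \<theta>" for i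
  proof -
    let ?p = "vertex P (Suc i)" and ?q = "vertex P (Suc (Suc i))" and ?o = "vertex P i"
    define u where "u = ?q - a *\<^sub>R ?p"
    define w where "w = ?o - a *\<^sub>R ?p"
    have in1: "?p \<bullet> ?q = a" "?p \<bullet> ?o = a" "?o \<bullet> ?p = a" "?q \<bullet> ?p = a" "?p \<bullet> ?p = 1" "?q \<bullet> ?q = 1" "?o \<bullet> ?o = 1"
      using step[of i] step[of "Suc i"] unit by (simp_all add: inner_commute norm_eq_1)
    \<comment> \<open>The angles are known only for indices below \<open>n\<close>, so the one at
      \<open>Suc i\<close> is read at \<open>Suc i mod n\<close>; its incoming side must still start
      at vertex \<open>i\<close>.\<close>
    have "(Suc i mod n + n - 1) mod n = i mod n"
    proof -
      have "(Suc i mod n + n - 1) mod n = (Suc i mod n + (n - 1)) mod n" using n by simp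
      also have "\<dots> = (Suc i + (n - 1)) mod n" by (rule mod_add_left_eq)
      also have "Suc i + (n - 1) = i + n" using n by simp
      finally show ?thesis by simp
    qed
    then have prev: "vertex P (Suc i mod n + n - 1) = ?o" by (metis period(1))
    have "direction ?p ?q = u" "direction ?p ?o = w" by (simp_all add: direction_def u_def w_def in1)
    then have "interior_angle P (Suc i mod n) = Arg2pi (Complex (u \<bullet> w) (?p \<bullet> (u \<times> w)))"
      by (simp add: interior_angle_def Let_def len period prev[unfolded One_nat_def])
    then have arg: "Arg2pi (Complex (u \<bullet> w) (?p \<bullet> (u \<times> w))) = \<theta>"
      using \<theta>(2)[of "Suc i mod n"] n by simp
    have "u \<bullet> u = 1 - a\<^sup>2" "w \<bullet> w = 1 - a\<^sup>2" "?p \<bullet> u = 0" "?p \<bullet> w = 0"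
      by (simp_all add: u_def w_def inner_diff in1 power2_eq_square)
    then have "cmod (Complex (u \<bullet> w) (?p \<bullet> (u \<times> w))) = sqrt (1 - a\<^sup>2) * sqrt (1 - a\<^sup>2)"
      using complex_inner_triple_norm[of ?p u w] unit by (simp add: norm_eq_sqrt_inner)
    also have "\<dots> = 1 - a\<^sup>2" using a by (simp add: abs_square_less_1 less_imp_le)
    finally have "Complex (u \<bullet> w) (?p \<bullet> (u \<times> w)) = of_real (1 - a\<^sup>2) * exp (\<i> * of_real \<theta>)"
      using Arg2pi_eq[of "Complex (u \<bullet> w) (?p \<bullet> (u \<times> w))"] arg by simp
    then have "u \<bullet> w = (1 - a\<^sup>2) * cos \<theta>" "?p \<bullet> (u \<times> w) = (1 - a\<^sup>2) * sin \<theta>"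
      by (simp_all add: complex_eq_iff Re_exp Im_exp)
    moreover have "u \<bullet> w = ?o \<bullet> ?q - a\<^sup>2"
      by (simp add: u_def w_def inner_diff in1 inner_commute[of ?q ?o] power2_eq_square)
    moreover have "?p \<bullet> (u \<times> w) = ?p \<bullet> (?q \<times> ?o)"
      by (simp add: u_def w_def Cross3.left_diff_distrib Cross3.right_diff_distrib cross_mult_left
          cross_mult_right inner_diff dot_cross_self)
    moreover have "?p \<bullet> (?q \<times> ?o) = ?o \<bullet> (?p \<times> ?q)" by (metis triple_product_rotate)
    ultimately show ?thesis by simp
  qed
  have "0 \<le> \<theta>" using \<theta>(2)[of 0] n Arg2pi_ge_0 by (auto simp: interior_angle_def Let_def)
  show ?thesis
    by (rule that[OF unit step a \<open>0 \<le> \<theta>\<close> \<theta>(1)]) (use angle in \<open>simp_all add: algebra_simps\<close>)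
qed

lemma regular_ngon_imp_regular_position:
  assumes P: "regular_ngon n P"
  obtains e1 e2 c h s \<phi> where "regular_position_polygon e1 e2 c h s \<phi> P n"
proof -
  obtain a \<theta> where unit: "\<And>i. norm (vertex P i) = 1"
    and step: "\<And>i. vertex P i \<bullet> vertex P (Suc i) = a" and a: "\<bar>a\<bar> < 1" and \<theta>: "0 \<le> \<theta>" "\<theta> < pi"
    and two: "\<And>i. vertex P i \<bullet> vertex P (Suc (Suc i)) = a\<^sup>2 + (1 - a\<^sup>2) * cos \<theta>"
    and triple: "\<And>i. vertex P i \<bullet> (vertex P (Suc i) \<times> vertex P (Suc (Suc i))) = (1 - a\<^sup>2) * sin \<theta>"
    using regular_ngon_angle[OF P] by blast
  have len: "length (vertices P) = n" and poly: "is_spherical_polygon P"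
    using P by (simp_all add: regular_ngon_def)
  have n: "3 \<le> n" and dist: "distinct (vertices P)"
    using poly by (simp_all add: is_spherical_polygon_def Let_def len)
  \<comment> \<open>At angle 0 a side would fold back onto the preceding one and end where that one
    began, which distinctness of the vertices forbids.\<close>
  have "vertex P 0 \<noteq> vertex P 2" using dist n by (simp add: vertex_def len nth_eq_iff_index_eq)
  then have "vertex P 0 \<bullet> vertex P 2 < 1" by (intro unit_inner_less_1 unit)
  then have "\<theta> \<noteq> 0" using two[of 0] by (auto simp: numeral_2_eq_2)
  then have "0 < sin \<theta>" using \<theta> by (intro sin_gt_zero) auto
  moreover have "0 < 1 - a\<^sup>2" using a by (simp add: abs_square_less_1)
  ultimately have pos: "0 < (1 - a\<^sup>2) * sin \<theta>" by simp
  interpret chain: left_turning_chain "vertex P" a "a\<^sup>2 + (1 - a\<^sup>2) * cos \<theta>" "(1 - a\<^sup>2) * sin \<theta>"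
    by unfold_locales (fact unit step two triple pos)+
  obtain e1 e2 c h s \<phi> where "oriented_frame e1 e2 c" and hs: "0 < h" "0 < s" "h\<^sup>2 + s\<^sup>2 = 1"
    "0 < \<phi>" "\<phi> < pi" and v: "\<And>i. vertex P i = h *\<^sub>R c + s *\<^sub>R oriented_frame.E e1 e2 (i * \<phi>)"
    using chain.cylindrical_form by blast
  interpret frame: oriented_frame e1 e2 c by fact
  interpret pos: regular_position e1 e2 c h s \<phi> by unfold_locales (fact hs)+
  have "regular_position_polygon e1 e2 c h s \<phi> P n"
    by unfold_locales (use poly len v in \<open>simp_all add: pos.v_def\<close>)
  then show ?thesis by (rule that)
qed

lemma regular_ngon_perim:
  assumes "regular_ngon n P"
  shows "0 < area P" "area P < 2 * pi" "perim P = perim_of_area n (area P)"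
proof -
  obtain e1 e2 c h s \<phi> where "regular_position_polygon e1 e2 c h s \<phi> P n"
    using regular_ngon_imp_regular_position[OF assms] by blast
  then interpret regular_position_polygon e1 e2 c h s \<phi> P n .
  show "0 < area P" "area P < 2 * pi" "perim P = perim_of_area n (area P)"
    by (fact area_bounds perim_eq)+
qed

theorem corollary2p5:
  fixes n k :: nat
    and P :: "nat \<Rightarrow> spherical_polygon" and Q :: spherical_polygon
  assumes "3 \<le> n" and "1 \<le> k"
    and "\<And>i. i \<in> {1..k} \<Longrightarrow> regular_ngon n (P i)"
    and "regular_ngon n Q"
    and "(\<Sum>i=1..k. area (P i)) = area Q"
  shows "perim Q \<le> (\<Sum>i=1..k. perim (P i)) \<and>
         (perim Q = (\<Sum>i=1..k. perim (P i)) \<longrightarrow> k = 1)"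
proof -
  have "(\<Sum>i=1..k. perim (P i)) = (\<Sum>i=1..k. perim_of_area n (area (P i)))"
    using regular_ngon_perim(3)[OF assms(3)] by (rule sum.cong[OF refl])
  \<comment> \<open>The bound \<open>area Q < 2 * pi\<close> keeps the total area in the range where
    subadditivity is available.\<close>
  then show ?thesis
    using perim_of_area_sum[of n "{1..k}" "\<lambda>i. area (P i)"] assms
      regular_ngon_perim[OF assms(4)] regular_ngon_perim(1)[OF assms(3)] by simp
qed

end
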